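(* Let $n \in \mathbb{N}$ and let $f$ be a transcendental entire function of order $\rho < \frac12$. Set $$G(z) = \frac{\Delta^n f(z)}{f(z)}.$$ If $G$ is transcendental (i.e. not a rational function), then $G$ has infinitely many zeros. In particular, if $f$ has order less than $\min\{\frac1n, \frac12\}$, then $G$ is transcendental and has infinitely many zeros.
   Context: For a function $f$ meromorphic in the plane, the forward differences are defined by $\Delta f(z) = f(z+1) - f(z)$ and $\Delta^{n+1} f(z) = \Delta^n f(z+1) - \Delta^n f(z)$ for $n = 0,1,2,\ldots$ (with $\Delta^0 f = f$, $\Delta^1 f = \Delta f$). The order of an entire function is $\limsup_{r\to\infty} \frac{\log\log M(r,f)}{\log r}$ where $M(r,f)=\max_{|z|=r}|f(z)|$. *)

theory Defs
  imports "HOL-Complex_Analysis.Complex_Analysis" "HOL-Library.Liminf_Limsup"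
begin

fun fwd_diff :: "nat \<Rightarrow> (complex \<Rightarrow> complex) \<Rightarrow> complex \<Rightarrow> complex" where
  "fwd_diff 0 f = f"
| "fwd_diff (Suc n) f = (\<lambda>z. fwd_diff n f (z + 1) - fwd_diff n f z)"

definition max_mod :: "(complex \<Rightarrow> complex) \<Rightarrow> real \<Rightarrow> real" where
  "max_mod f r = Sup ((\<lambda>z. norm (f z)) ` sphere 0 r)"

definition entire_order :: "(complex \<Rightarrow> complex) \<Rightarrow> ereal" where
  "entire_order f = Limsup at_top (\<lambda>r::real. ereal (ln (ln (max_mod f r)) / ln r))"

definition transcendental_entire :: "(complex \<Rightarrow> complex) \<Rightarrow> bool" where
  "transcendental_entire f \<longleftrightarrow> f holomorphic_on UNIV \<and> \<not> (\<exists>p. \<forall>z. f z = poly p z)"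

text \<open>A (meromorphic) function is rational if it agrees with a quotient of polynomials
  in a punctured neighbourhood of every point (i.e. off a discrete set); this makes the
  notion insensitive to the (junk) values of g at its singularities.\<close>
definition rational_function :: "(complex \<Rightarrow> complex) \<Rightarrow> bool" where
  "rational_function g \<longleftrightarrow>
     (\<exists>p q. q \<noteq> 0 \<and> (\<forall>z. \<forall>\<^sub>F w in at z. g w = poly p w / poly q w))"

definition mero_zeros :: "(complex \<Rightarrow> complex) \<Rightarrow> complex set" where
  "mero_zeros g = {z. (g \<longlongrightarrow> 0) (at z)}"

end

theory Submission
  imports Defs "HOL-Real_Asymp.Real_Asymp"
begin

text \<open>Write \<open>M r f\<close> for the maximum modulus. Comparing \<open>f\<close> with monomials on annuli shows
  \<open>M (r + s) f = O(M r f)\<close> for \<open>s = O(r powr (1 - l))\<close> and all large \<open>r\<close>, whenever \<open>f\<close> has growth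
  exponent \<open>l < 1\<close>. By Cauchy's estimates the \<open>n\<close>-th difference then differs from the \<open>n\<close>-th
  derivative by little, so its maximum modulus exceeds any multiple of \<open>r ^ (- n) * M r f\<close> and is
  \<open>O(r powr (n * l - n) * M r f)\<close>. If \<open>n * l < 1\<close>, no rational \<open>G\<close> is compatible with both bounds.

  If \<open>G\<close> has finitely many zeros, then \<open>Q f = H \<Delta>\<^sup>n f\<close> with a polynomial \<open>Q\<close> and an entire \<open>H\<close>.
  The function \<open>H\<close> is a limit of products over its zeros, which are zeros of \<open>Q f\<close>, so that for
  \<open>l < 1/2\<close> Wiman's theorem applies: unless \<open>H\<close> is a polynomial, on suitable circles its minimum
  modulus exceeds every power of the radius. There \<open>\<Delta>\<^sup>n f\<close> would be too small compared with \<open>f\<close>,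
  contradicting the lower bound. Hence \<open>H\<close> is a polynomial and \<open>G = Q / H\<close> is rational.\<close>

section \<open>Growth of entire functions\<close>

text \<open>The two bounds exclude a rational G by integrality. On large circles a rational G has
  the size of an integer power of r. If n l < 1, the upper bound r^(-n + n l) pushes this integer
  down to -n or below, and the lower bound, which exceeds every fixed multiple of r^(-n), excludes
  that as well. The number 1/2 comes from the minimum modulus: passing to a square root of the
  variable doubles growth exponents, and the Phragmen--Lindelof argument in a half plane only
  tolerates exponents below 1. The shaping obstacle is that a quotient of two entire functions
  carries no growth bound of its own. Infinite products are avoided altogether; finite products on
  discs are used, with constants independent of the disc. In \<open>growth\<close> the estimate
  holds on the whole plane, with \<open>1 + norm z\<close> in place of \<open>norm z\<close>, so
  that no exceptional disc has to be carried along; the gap between the order and \<open>l\<close>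
  absorbs the constants.\<close>

definition growth :: "real \<Rightarrow> (complex \<Rightarrow> complex) \<Rightarrow> bool" where
  "growth l f \<longleftrightarrow> f holomorphic_on UNIV \<and>
     (\<exists>C\<ge>0. \<forall>z. norm (f z) \<le> exp (C * (1 + norm z) powr l))"

text \<open>The working form of transcendence: it enters estimates directly and passes to
  derivatives by the mean value inequality.\<close>

definition superpoly :: "(complex \<Rightarrow> complex) \<Rightarrow> bool" where
  "superpoly f \<longleftrightarrow> (\<forall>k::nat. \<forall>B. \<forall>\<^sub>F r in at_top. B * r ^ k \<le> max_mod f r)"

lemma entire_continuous: "f holomorphic_on UNIV \<Longrightarrow> continuous_on A f"
  using continuous_on_subset holomorphic_on_imp_continuous_on by blast

lemma entire_subset: "f holomorphic_on UNIV \<Longrightarrow> f holomorphic_on A"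
  using holomorphic_on_subset by blast

section \<open>Maximum modulus and the maximum principle\<close>

lemma max_mod_bdd:
  assumes "f holomorphic_on UNIV"
  shows "bdd_above ((\<lambda>z. norm (f z)) ` sphere 0 r)"
  by (intro compact_imp_bounded[THEN bounded_imp_bdd_above] compact_continuous_image continuous_intros
        entire_continuous assms) auto

lemma max_mod_le:
  assumes "r \<ge> 0" "\<And>z. norm z = r \<Longrightarrow> norm (f z) \<le> B"
  shows "max_mod f r \<le> B"
proof -
  have "sphere (0::complex) r \<noteq> {}" using assms(1) by simp
  then show ?thesis unfolding max_mod_def
    by (intro cSUP_least) (use assms in auto)
qed

lemma norm_le_max_mod_sphere:
  assumes "f holomorphic_on UNIV" "norm z = r"
  shows "norm (f z) \<le> max_mod f r"
  unfolding max_mod_def by (intro cSUP_upper max_mod_bdd) (use assms in auto)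

lemma max_mod_attained:
  assumes "f holomorphic_on UNIV" "r \<ge> 0"
  obtains z where "norm z = r" "norm (f z) = max_mod f r"
proof -
  have "sphere (0::complex) r \<noteq> {}" using assms(2) by simp
  then obtain z where z: "z \<in> sphere 0 r" "\<forall>y\<in>sphere 0 r. norm (f y) \<le> norm (f z)"
    using continuous_attains_sup[OF compact_sphere, of 0 r "\<lambda>z. norm (f z)"]
      continuous_on_norm[OF entire_continuous[OF assms(1)]] by blast
  have "max_mod f r \<le> norm (f z)" using z assms(2) by (intro max_mod_le) auto
  moreover have "norm (f z) \<le> max_mod f r" using z by (intro norm_le_max_mod_sphere assms) auto
  ultimately show ?thesis using that z by force
qed

lemma norm_le_max_mod:
  assumes "f holomorphic_on UNIV" "norm z \<le> r"
  shows "norm (f z) \<le> max_mod f r"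
proof (rule maximum_modulus_frontier[of f "cball 0 r"])
  show "f holomorphic_on interior (cball 0 r)" using assms entire_subset by blast
  show "continuous_on (closure (cball 0 r)) f" using assms entire_continuous by blast
  show "norm (f z) \<le> max_mod f r" if "z \<in> frontier (cball 0 r)" for z
    using that by (intro norm_le_max_mod_sphere assms) auto
qed (use assms in auto)

lemma max_mod_nonneg:
  assumes "f holomorphic_on UNIV" "r \<ge> 0" shows "max_mod f r \<ge> 0"
  using norm_le_max_mod[OF assms(1), of 0 r] assms(2) norm_ge_zero[of "f 0"]
  by (simp del: norm_ge_zero)

lemma max_mod_mono:
  assumes "f holomorphic_on UNIV" "0 \<le> r" "r \<le> s" shows "max_mod f r \<le> max_mod f s"
  by (intro max_mod_le norm_le_max_mod) (use assms in auto)

text \<open>The maximum principle for \<open>f z / z ^ N\<close> on an annulus: with \<open>N\<close> suitably chosen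
  this replaces Hadamard's three circles theorem.\<close>

lemma annulus_bound:
  assumes f: "f holomorphic_on UNIV" and r: "0 < r1" "r1 \<le> norm z" "norm z \<le> r2"
  shows "norm (f z) \<le> norm z ^ N * max (max_mod f r1 / r1 ^ N) (max_mod f r2 / r2 ^ N)"
proof -
  let ?S = "cball 0 r2 - ball (0::complex) r1"
  let ?B = "max (max_mod f r1 / r1 ^ N) (max_mod f r2 / r2 ^ N)"
  have cl: "closed ?S" by (rule closed_Diff[OF closed_cball open_ball])
  have "norm (f z / z ^ N) \<le> ?B"
  proof (rule maximum_modulus_frontier[of "\<lambda>z. f z / z ^ N" ?S])
    have hol: "(\<lambda>z. f z / z ^ N) holomorphic_on ?S"
      by (rule holomorphic_on_divide[OF entire_subset[OF f] holomorphic_on_power[OF holomorphic_on_ident]])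
         (use r in auto)
    show "(\<lambda>z. f z / z ^ N) holomorphic_on interior ?S"
      by (rule holomorphic_on_subset[OF hol interior_subset])
    show "continuous_on (closure ?S) (\<lambda>z. f z / z ^ N)"
      unfolding closure_closed[OF cl] by (rule holomorphic_on_imp_continuous_on[OF hol])
    show "bounded ?S" by (meson Diff_subset bounded_cball bounded_subset)
    show "z \<in> ?S" using r by auto
    fix w assume w: "w \<in> frontier ?S"
    have "frontier ?S \<subseteq> frontier (cball 0 r2) \<union> frontier (ball 0 r1)"
      using frontier_Int_subset[of "cball 0 r2" "- ball (0::complex) r1"]
      by (auto simp: Diff_eq frontier_complement)
    moreover have "frontier (cball 0 r2) \<subseteq> sphere (0::complex) r2" "frontier (ball 0 r1) \<subseteq> sphere (0::complex) r1"
      using r by (simp_all add: frontier_cball frontier_ball)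
    ultimately have "w \<in> sphere 0 r2 \<union> sphere 0 r1" using w by blast
    then have "norm w = r2 \<or> norm w = r1" by auto
    then show "norm (f w / w ^ N) \<le> ?B"
    proof
      assume w: "norm w = r2"
      then have "norm (f w / w ^ N) \<le> max_mod f r2 / r2 ^ N"
        using norm_le_max_mod_sphere[OF f w] r
        by (simp add: norm_divide norm_power divide_right_mono)
      then show ?thesis by simp
    next
      assume w: "norm w = r1"
      then have "norm (f w / w ^ N) \<le> max_mod f r1 / r1 ^ N"
        using norm_le_max_mod_sphere[OF f w] r
        by (simp add: norm_divide norm_power divide_right_mono)
      then show ?thesis by simp
    qed
  qed
  moreover have "norm z > 0" using r by linarith
  ultimately show ?thesis
    by (simp add: norm_divide norm_power pos_divide_le_eq mult.commute)
qed

lemma growthD: "growth l f \<Longrightarrow> f holomorphic_on UNIV"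
  by (simp add: growth_def)

lemma growthE:
  assumes "growth l f"
  obtains C where "C \<ge> 0" "\<And>z. norm (f z) \<le> exp (C * (1 + norm z) powr l)"
  using assms unfolding growth_def by blast

text \<open>For a suitable \<open>N\<close> of order \<open>r powr l\<close> the inner circle
  dominates in the comparison of \<open>f\<close> with \<open>z ^ N\<close> between the radii
  \<open>r\<close> and \<open>2 * r\<close>. The quotient of the maxima is then at most
  \<open>(1 + s / r) ^ N \<le> exp (N * s / r)\<close>, which is bounded for
  \<open>s = O(r powr (1 - l))\<close>. The factor 2 leaves room for a shift by \<open>n\<close>
  together with a Cauchy radius \<open>r powr (1 - l)\<close>.\<close>

lemma max_mod_shift:
  assumes g: "growth l f" and l: "0 < l" "l < 1" and nz: "f z1 \<noteq> 0"
  obtains K where "K \<ge> 0"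
    "\<forall>\<^sub>F r in at_top. \<forall>s. 0 \<le> s \<and> s \<le> 2 * r powr (1 - l) \<longrightarrow> max_mod f (r + s) \<le> K * max_mod f r"
proof -
  note hol = growthD[OF g]
  obtain C where C: "C \<ge> 0" "\<And>z. norm (f z) \<le> exp (C * (1 + norm z) powr l)"
    using growthE[OF g] by blast
  define m0 where "m0 = norm (f z1)"
  have m0: "m0 > 0" using nz by (simp add: m0_def)
  define D where "D = 1 + (C * 3 powr l + \<bar>ln m0\<bar>) / ln 2"
  have "\<forall>\<^sub>F r in at_top. 2 * r powr (1 - l) \<le> r" using l by real_asymp
  moreover have "\<forall>\<^sub>F r in at_top. r \<ge> max 1 (norm z1)" by (rule eventually_ge_at_top)
  ultimately have "\<forall>\<^sub>F r in at_top. \<forall>s. 0 \<le> s \<and> s \<le> 2 * r powr (1 - l) \<longrightarrow>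
      max_mod f (r + s) \<le> exp (2 * D) * max_mod f r"
  proof eventually_elim
    case (elim r)
    then have r: "r \<ge> 1" "norm z1 \<le> r" by auto
    have Mr: "max_mod f r \<ge> m0" using norm_le_max_mod[OF hol r(2)] by (simp add: m0_def)
    have M2: "max_mod f (2 * r) \<ge> m0" using max_mod_mono[OF hol, of r "2 * r"] Mr r by simp
    \<comment> \<open>The least exponent with \<open>max_mod f (2 * r) \<le> 2 ^ N * m0\<close>. As
      \<open>m0 \<le> max_mod f r\<close>, this makes the inner circle dominate, while the growth of
      \<open>f\<close> gives \<open>N = O(r powr l)\<close>.\<close>
    define N where "N = nat \<lceil>log 2 (max_mod f (2 * r) / m0)\<rceil>"
    have pos: "max_mod f (2 * r) / m0 > 0" using m0 M2 by simp
    have "log 2 (max_mod f (2 * r) / m0) \<le> real N" unfolding N_def by linarith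
    then have N1: "max_mod f (2 * r) / m0 \<le> 2 ^ N"
      using pos by (simp add: log_le_iff powr_realpow)
    have lp: "log 2 (max_mod f (2 * r) / m0) \<ge> 0" using M2 m0 by simp
    have "max_mod f (2 * r) \<le> exp (C * (3 * r) powr l)"
    proof (rule max_mod_le)
      fix z :: complex assume "norm z = 2 * r"
      then have "norm (f z) \<le> exp (C * (1 + 2 * r) powr l)" using C(2)[of z] by simp
      also have "\<dots> \<le> exp (C * (3 * r) powr l)"
        using r l C by (intro iffD2[OF exp_le_cancel_iff] mult_left_mono powr_mono2) auto
      finally show "norm (f z) \<le> exp (C * (3 * r) powr l)" .
    qed (use r in simp)
    then have "ln (max_mod f (2 * r)) \<le> C * (3 * r) powr l"
      using M2 m0 by (subst ln_exp[symmetric], subst ln_le_cancel_iff) auto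
    moreover have "real N \<le> 1 + log 2 (max_mod f (2 * r) / m0)"
      unfolding N_def using lp by linarith
    moreover have "log 2 (max_mod f (2 * r) / m0) = (ln (max_mod f (2 * r)) - ln m0) / ln 2"
      using M2 m0 by (simp add: log_def ln_div)
    moreover have "(ln (max_mod f (2 * r)) - ln m0) / ln 2 \<le> (C * (3 * r) powr l + \<bar>ln m0\<bar>) / ln 2"
      if "ln (max_mod f (2 * r)) \<le> C * (3 * r) powr l"
      using that by (intro divide_right_mono) auto
    ultimately have "real N \<le> 1 + (C * (3 * r) powr l + \<bar>ln m0\<bar>) / ln 2"
      by linarith
    also have "\<dots> \<le> r powr l + (C * (3 powr l * r powr l) + \<bar>ln m0\<bar> * r powr l) / ln 2"
    proof -
      have "1 \<le> r powr l" using r l by (simp add: ge_one_powr_ge_zero)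
      moreover from this have "\<bar>ln m0\<bar> * 1 \<le> \<bar>ln m0\<bar> * r powr l" by (intro mult_left_mono) auto
      ultimately show ?thesis using r by (intro add_mono divide_right_mono) (auto simp: powr_mult)
    qed
    also have "\<dots> = D * r powr l" by (simp add: D_def field_simps)
    finally have N2: "real N \<le> D * r powr l" .
    show ?case
    proof (intro allI impI)
      fix s assume s: "0 \<le> s \<and> s \<le> 2 * r powr (1 - l)"
      have B: "max_mod f (2 * r) / (2 * r) ^ N \<le> max_mod f r / r ^ N"
      proof -
        have "max_mod f (2 * r) \<le> 2 ^ N * m0" using N1 m0 by (simp add: field_simps)
        also have "\<dots> \<le> 2 ^ N * max_mod f r" using Mr by simp
        finally show ?thesis using r by (simp add: power_mult_distrib field_simps)
      qed
      have "(1 + s / r) ^ N \<le> exp (s / r) ^ N"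
        using s r by (intro power_mono exp_ge_add_one_self) auto
      also have "\<dots> = exp (real N * (s / r))" by (simp only: exp_of_nat_mult)
      also have "\<dots> \<le> exp (2 * D)"
      proof -
        have "real N * (s / r) \<le> (D * r powr l) * ((2 * r powr (1 - l)) / r)"
          using N2 s r by (intro mult_mono divide_right_mono) auto
        also have "\<dots> = 2 * D * (r powr l * r powr (1 - l)) / r" by simp
        also have "r powr l * r powr (1 - l) = r" using r by (simp flip: powr_add)
        finally show ?thesis using r by simp
      qed
      finally have E: "(1 + s / r) ^ N \<le> exp (2 * D)" .
      show "max_mod f (r + s) \<le> exp (2 * D) * max_mod f r"
      proof (rule max_mod_le)
        fix z :: complex assume z: "norm z = r + s"
        have "norm (f z) \<le> norm z ^ N * max (max_mod f r / r ^ N) (max_mod f (2 * r) / (2 * r) ^ N)"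
          using s elim r z by (intro annulus_bound hol) auto
        also have "\<dots> = (r + s) ^ N * (max_mod f r / r ^ N)" using B z by (simp add: max_def)
        also have "\<dots> = (1 + s / r) ^ N * max_mod f r"
        proof -
          have "1 + s / r = (r + s) / r" using r by (simp add: field_simps)
          then show ?thesis by (simp add: power_divide)
        qed
        also have "\<dots> \<le> exp (2 * D) * max_mod f r" using E Mr m0 by (intro mult_right_mono) auto
        finally show "norm (f z) \<le> exp (2 * D) * max_mod f r" .
      qed (use r s in simp)
    qed
  qed
  then show ?thesis using that[of "exp (2 * D)"] by simp
qed

text \<open>Cauchy's inequality needs only arbitrarily large radii with
  \<open>max_mod f r < B * r ^ k\<close>: they already force all Taylor coefficients of index above
  \<open>k\<close> to vanish.\<close>

lemma transcendental_imp_superpoly: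
  assumes "transcendental_entire f"
  shows "superpoly f"
proof (rule ccontr)
  have hol: "f holomorphic_on UNIV" using assms by (simp add: transcendental_entire_def)
  assume "\<not> superpoly f"
  then obtain k B where kB: "\<not> (\<forall>\<^sub>F r in at_top. B * r ^ k \<le> max_mod f r)"
    unfolding superpoly_def by blast
  have z: "(deriv ^^ j) f 0 = 0" if j: "j > k" for j
  proof (rule ccontr)
    assume "(deriv ^^ j) f 0 \<noteq> 0"
    then have pos: "norm ((deriv ^^ j) f 0) > 0" by simp
    have "((\<lambda>r::real. fact j * \<bar>B\<bar> * r powr (- real (j - k))) \<longlongrightarrow> 0) at_top"
      using j by (intro tendsto_mult_right_zero tendsto_neg_powr filterlim_ident) auto
    then have "\<forall>\<^sub>F r in at_top. fact j * \<bar>B\<bar> * r powr (- real (j - k)) < norm ((deriv ^^ j) f 0)"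
      using order_tendstoD(2)[OF _ pos] by blast
    moreover have "\<forall>\<^sub>F r::real in at_top. r > 0" by (rule eventually_gt_at_top)
    ultimately have "\<forall>\<^sub>F r in at_top. B * r ^ k \<le> max_mod f r"
    proof eventually_elim
      case (elim r)
      show ?case
      proof (rule ccontr)
        assume "\<not> B * r ^ k \<le> max_mod f r"
        then have lt: "max_mod f r < B * r ^ k" by simp
        have "norm ((deriv ^^ j) f 0) \<le> fact j * max_mod f r / r ^ j"
          by (rule Cauchy_inequality) (auto intro: norm_le_max_mod[OF hol] entire_subset[OF hol] entire_continuous[OF hol] elim)
        also have "\<dots> \<le> fact j * (\<bar>B\<bar> * r ^ k) / r ^ j"
        proof -
          have "B * r ^ k \<le> \<bar>B\<bar> * r ^ k" using elim by (intro mult_right_mono) auto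
          then have "max_mod f r \<le> \<bar>B\<bar> * r ^ k" using lt by linarith
          then show ?thesis using elim by (intro divide_right_mono mult_left_mono) auto
        qed
        also have "\<dots> = fact j * \<bar>B\<bar> * r powr (- real (j - k))"
        proof -
          have "r ^ j = r ^ (j - k) * r ^ k" using j by (simp flip: power_add)
          moreover have "r powr (- real (j - k)) = inverse (r ^ (j - k))"
            using elim by (simp add: powr_minus powr_realpow del: of_nat_diff)
          ultimately show ?thesis using elim by (simp add: field_simps del: of_nat_diff)
        qed
        finally show False using elim by simp
      qed
    qed
    then show False using kB by contradiction
  qed
  have "f z = poly (\<Sum>j\<le>k. monom ((deriv ^^ j) f 0 / fact j) j) z" for z
  proof -
    have "(\<lambda>n. (deriv ^^ n) f 0 / fact n * (z - 0)^n) sums f z"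
      by (rule holomorphic_power_series[of f 0 "norm z + 1"]) (auto intro: entire_subset[OF hol])
    moreover have "(\<lambda>n. (deriv ^^ n) f 0 / fact n * (z - 0)^n) sums (\<Sum>n\<le>k. (deriv ^^ n) f 0 / fact n * (z - 0)^n)"
      by (intro sums_finite) (auto simp: z)
    ultimately show ?thesis by (auto simp: sums_iff poly_sum poly_monom)
  qed
  then show False using assms unfolding transcendental_entire_def by blast
qed

lemma entire_deriv:
  assumes "f holomorphic_on UNIV"
  shows "deriv f holomorphic_on UNIV" "(deriv ^^ n) f holomorphic_on UNIV"
  using holomorphic_deriv[OF assms] holomorphic_higher_deriv[OF assms] by auto

lemma entire_field_derivative:
  assumes "f holomorphic_on UNIV"
  shows "(f has_field_derivative deriv f z) (at z within A)"
  using assms by (meson holomorphic_derivI iso_tuple_UNIV_I open_UNIV has_field_derivative_at_within)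

lemma entire_diff_bound:
  assumes "f holomorphic_on UNIV" "\<And>z. z \<in> S \<Longrightarrow> norm (deriv f z) \<le> B" "convex S" "x \<in> S" "y \<in> S"
  shows "norm (f x - f y) \<le> B * norm (x - y)"
  by (rule field_differentiable_bound[of S f "deriv f"])
     (use assms entire_field_derivative in auto)

lemma superpoly_deriv:
  assumes hol: "f holomorphic_on UNIV" and "superpoly f"
  shows "superpoly (deriv f)"
  unfolding superpoly_def
proof (intro allI)
  fix k :: nat and B :: real
  \<comment> \<open>The exponent \<open>Suc k\<close> pays for the factor \<open>r\<close> of the
    mean value inequality, the summand \<open>norm (f 0)\<close> for the value at the
    centre.\<close>
  have "\<forall>\<^sub>F r in at_top. (\<bar>B\<bar> + norm (f 0)) * r ^ Suc k \<le> max_mod f r"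
    using assms(2) unfolding superpoly_def by blast
  moreover have "\<forall>\<^sub>F r::real in at_top. r \<ge> 1" by (rule eventually_ge_at_top)
  ultimately show "\<forall>\<^sub>F r in at_top. B * r ^ k \<le> max_mod (deriv f) r"
  proof eventually_elim
    case (elim r)
    obtain z where z: "norm z = r" "norm (f z) = max_mod f r"
      using max_mod_attained[OF hol, of r] elim by auto
    have "norm (f z - f 0) \<le> max_mod (deriv f) r * norm (z - 0)"
      by (rule entire_diff_bound[OF hol norm_le_max_mod[OF entire_deriv(1)[OF hol]], of "cball 0 r"])
         (use elim z in auto)
    then have a: "max_mod f r \<le> norm (f 0) + r * max_mod (deriv f) r"
      using z norm_triangle_ineq2[of "f z" "f 0"] by (simp add: mult.commute)
    have "norm (f 0) * 1 \<le> norm (f 0) * r ^ Suc k"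
      using elim by (intro mult_left_mono one_le_power) auto
    then have "r * (\<bar>B\<bar> * r ^ k) \<le> r * max_mod (deriv f) r"
      using a elim(1) by (simp add: algebra_simps)
    then have "\<bar>B\<bar> * r ^ k \<le> max_mod (deriv f) r" using elim by simp
    moreover have "B * r ^ k \<le> \<bar>B\<bar> * r ^ k" using elim by (intro mult_right_mono) auto
    ultimately show ?case by linarith
  qed
qed

text \<open>From radius \<open>q * r\<close> to radius \<open>r\<close> the maximum modulus at least
  doubles, because \<open>f\<close> outgrows \<open>z ^ K\<close>. Hence \<open>f\<close> changes by
  at least half its maximum along a short radial segment, and the derivative must be large on the
  disc.\<close>

lemma max_mod_deriv_ge:
  assumes hol: "f holomorphic_on UNIV" and sp: "superpoly f" and m: "m \<ge> (1::real)"
  shows "\<forall>\<^sub>F r in at_top. m * max_mod f r \<le> r * max_mod (deriv f) r"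
proof -
  \<comment> \<open>The segment from \<open>q * z\<close> to \<open>z\<close> gets length
    \<open>r / (2 * m)\<close>, so that a change of \<open>max_mod f r / 2\<close> means the slope
    \<open>m * max_mod f r / r\<close>.\<close>
  define q where "q = 1 - 1 / (2 * m)"
  have q: "0 < q" "q < 1" using m by (auto simp: q_def field_simps)
  obtain K where K: "q ^ K < 1 / 2" using real_arch_pow_inv[of "1/2" q] q by auto
  have "\<forall>\<^sub>F r in at_top. (2 * max_mod f 1) * r ^ K \<le> max_mod f r"
    using sp unfolding superpoly_def by blast
  moreover have "\<forall>\<^sub>F r::real in at_top. r \<ge> max 1 (1 / q)" by (rule eventually_ge_at_top)
  ultimately show ?thesis
  proof eventually_elim
    case (elim r)
    then have r: "r \<ge> 1" by simp
    have "q * r \<ge> 1" using elim q by (simp add: field_simps)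
    note r = r this
    have qr: "q * r \<le> r" using q r by simp
    have half: "max_mod f (q * r) \<le> max_mod f r / 2"
    proof (rule max_mod_le)
      fix z :: complex assume z: "norm z = q * r"
      have "norm (f z) \<le> norm z ^ K * max (max_mod f 1 / 1 ^ K) (max_mod f r / r ^ K)"
        using r z qr by (intro annulus_bound hol) auto
      also have "\<dots> \<le> max_mod f r / 2"
      \<comment> \<open>If the outer circle dominates, \<open>q ^ K < 1 / 2\<close> gives the factor
        one half; if the unit circle dominates, superpolynomial growth gives it.\<close>
      proof (cases "max_mod f 1 / 1 ^ K \<le> max_mod f r / r ^ K")
        case True
        then have "norm z ^ K * max (max_mod f 1 / 1 ^ K) (max_mod f r / r ^ K)
          = q ^ K * max_mod f r" using r z by (simp add: max_def power_mult_distrib)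
        also have "\<dots> \<le> 1 / 2 * max_mod f r"
          using K max_mod_nonneg[OF hol, of r] r by (intro mult_right_mono) auto
        finally show ?thesis by simp
      next
        case False
        then have "norm z ^ K * max (max_mod f 1 / 1 ^ K) (max_mod f r / r ^ K)
          = (q * r) ^ K * max_mod f 1" using z by (simp add: max_def)
        also have "\<dots> \<le> r ^ K * max_mod f 1"
          using r qr max_mod_nonneg[OF hol, of 1] by (intro mult_right_mono power_mono) auto
        finally show ?thesis using elim(1) by (simp add: mult_ac)
      qed
      finally show "norm (f z) \<le> max_mod f r / 2" .
    qed (use r in simp)
    obtain z where z: "norm z = r" "norm (f z) = max_mod f r"
      using max_mod_attained[OF hol, of r] r by auto
    have nqz: "norm (of_real q * z) = q * r" using z q by (simp add: norm_mult)
    have "norm (f z - f (of_real q * z)) \<le> max_mod (deriv f) r * norm (z - of_real q * z)"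
      by (rule entire_diff_bound[OF hol norm_le_max_mod[OF entire_deriv(1)[OF hol]], of "cball 0 r"])
         (use r z nqz qr in auto)
    also have "norm (z - of_real q * z) = r / (2 * m)"
    proof -
      have "z - of_real q * z = of_real (1 / (2 * m)) * z" by (simp add: q_def algebra_simps)
      then show ?thesis using z m by (simp add: norm_mult norm_divide)
    qed
    finally have "norm (f z - f (of_real q * z)) \<le> max_mod (deriv f) r * (r / (2 * m))" .
    moreover have "norm (f (of_real q * z)) \<le> max_mod f r / 2"
      using half norm_le_max_mod_sphere[OF hol nqz] by linarith
    ultimately have "max_mod f r / 2 \<le> max_mod (deriv f) r * (r / (2 * m))"
      using z norm_triangle_ineq2[of "f z" "f (of_real q * z)"] by linarith
    then show ?case using m by (simp add: field_simps)
  qed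
qed

lemma superpoly_higher_deriv:
  assumes "f holomorphic_on UNIV" "superpoly f"
  shows "superpoly ((deriv ^^ n) f)"
  by (induction n) (simp_all add: assms superpoly_deriv[OF entire_deriv(2)])

lemma max_mod_higher_deriv_ge:
  assumes hol: "f holomorphic_on UNIV" and sp: "superpoly f" and m: "m \<ge> (1::real)"
  shows "\<forall>\<^sub>F r in at_top. m ^ n * max_mod f r \<le> r ^ n * max_mod ((deriv ^^ n) f) r"
proof (induction n)
  case (Suc n)
  have "\<forall>\<^sub>F r in at_top. m * max_mod ((deriv ^^ n) f) r \<le> r * max_mod (deriv ((deriv ^^ n) f)) r"
    by (rule max_mod_deriv_ge[OF entire_deriv(2)[OF hol] superpoly_higher_deriv[OF hol sp] m])
  with Suc eventually_ge_at_top[of 0] show ?case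
  proof eventually_elim
    case (elim r)
    have "m ^ Suc n * max_mod f r = m * (m ^ n * max_mod f r)" by simp
    also have "\<dots> \<le> m * (r ^ n * max_mod ((deriv ^^ n) f) r)"
      using elim m by (intro mult_left_mono) auto
    also have "\<dots> = r ^ n * (m * max_mod ((deriv ^^ n) f) r)" by simp
    also have "\<dots> \<le> r ^ n * (r * max_mod (deriv ((deriv ^^ n) f)) r)"
      using elim by (intro mult_left_mono) auto
    finally show ?case by (simp add: algebra_simps)
  qed
qed auto

section \<open>Differences and derivatives\<close>

lemma higher_deriv_bound:
  assumes hol: "f holomorphic_on UNIV" and s: "s > 0" "norm w + s \<le> R"
  shows "norm ((deriv ^^ n) f w) \<le> fact n * max_mod f R / s ^ n"
proof (rule Cauchy_inequality)
  show "f holomorphic_on ball w s" "continuous_on (cball w s) f"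
    using entire_subset[OF hol] entire_continuous[OF hol] by auto
  fix x assume "norm (w - x) = s"
  then have "norm x \<le> R" using norm_triangle_ineq3[of w x] s by linarith
  then show "norm (f x) \<le> max_mod f R" by (rule norm_le_max_mod[OF hol])
qed fact

lemma growth_deriv:
  assumes g: "growth l f" and l: "l \<ge> 0"
  shows "growth l (deriv f)"
proof -
  note hol = growthD[OF g]
  obtain C where C: "C \<ge> 0" "\<And>z. norm (f z) \<le> exp (C * (1 + norm z) powr l)"
    using growthE[OF g] by blast
  have "norm (deriv f z) \<le> exp ((C * 2 powr l) * (1 + norm z) powr l)" for z
  proof -
    have "norm ((deriv ^^ 1) f z) \<le> fact 1 * max_mod f (norm z + 1) / 1 ^ 1"
      by (rule higher_deriv_bound[OF hol]) auto
    also have "\<dots> \<le> exp (C * (2 * (1 + norm z)) powr l)"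
    proof -
      have "max_mod f (norm z + 1) \<le> exp (C * (2 * (1 + norm z)) powr l)"
      proof (rule max_mod_le)
        fix w :: complex assume w: "norm w = norm z + 1"
        have "norm (f w) \<le> exp (C * (1 + norm w) powr l)" by (rule C)
        also have "\<dots> \<le> exp (C * (2 * (1 + norm z)) powr l)"
          unfolding exp_le_cancel_iff using w l C by (intro mult_left_mono powr_mono2) auto
        finally show "norm (f w) \<le> exp (C * (2 * (1 + norm z)) powr l)" .
      qed simp
      then show ?thesis by simp
    qed
    also have "C * (2 * (1 + norm z)) powr l = (C * 2 powr l) * (1 + norm z) powr l"
      by (subst powr_mult) auto
    finally show ?thesis by simp
  qed
  then show ?thesis
    unfolding growth_def using entire_deriv(1)[OF hol] C(1) by (auto intro!: exI[of _ "C * 2 powr l"])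
qed

lemma growth_higher_deriv: "growth l f \<Longrightarrow> l \<ge> 0 \<Longrightarrow> growth l ((deriv ^^ n) f)"
  by (induction n) (simp_all add: growth_deriv)

lemma fwd_diff_holomorphic:
  assumes "f holomorphic_on UNIV" shows "fwd_diff n f holomorphic_on UNIV"
proof (induction n)
  case (Suc n)
  have "(fwd_diff n f \<circ> (\<lambda>z. z + 1)) holomorphic_on UNIV"
    by (rule holomorphic_on_compose[OF _ entire_subset[OF Suc]]) (intro holomorphic_intros)
  then show ?case using Suc by (auto intro!: holomorphic_on_diff simp: o_def)
qed (use assms in simp)

lemma has_field_derivative_fwd_diff:
  assumes "f holomorphic_on UNIV"
  shows "(fwd_diff n f has_field_derivative fwd_diff n (deriv f) z) (at z)"
proof (induction n arbitrary: z)
  case 0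
  then show ?case using entire_field_derivative[OF assms] by simp
next
  case (Suc n)
  have "((\<lambda>z. fwd_diff n f (z + 1)) has_field_derivative fwd_diff n (deriv f) (z + 1)) (at z)"
    using Suc[of "z + 1"] by (simp add: DERIV_shift)
  then show ?case using Suc[of z] by (auto intro!: derivative_intros)
qed

text \<open>A further difference is an increment of \<open>fwd_diff n f\<close> over a unit step,
  and the derivative of \<open>fwd_diff n f\<close> is \<open>fwd_diff n (deriv f)\<close>. The
  induction hypothesis for \<open>deriv f\<close> shows that this derivative is nearly constant on
  the unit disc around \<open>z\<close>; each step costs one more \<open>B\<close>.\<close>

lemma fwd_diff_approx:
  assumes "f holomorphic_on UNIV"
    and "\<And>w. norm (w - z) \<le> real n \<Longrightarrow> norm ((deriv ^^ Suc n) f w) \<le> B"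
  shows "norm (fwd_diff n f z - (deriv ^^ n) f z) \<le> real n * B"
  using assms
proof (induction n arbitrary: f z)
  case 0
  then show ?case by simp
next
  case (Suc n)
  note hol = Suc.prems(1)
  have D: "(deriv ^^ k) (deriv f) = (deriv ^^ Suc k) f" for k
    by (simp only: funpow_Suc_right o_def)
  let ?c = "(deriv ^^ Suc n) f z"
  have bd: "norm (fwd_diff n (deriv f) w - ?c) \<le> real (Suc n) * B" if w: "w \<in> cball z 1" for w
  proof -
    have "norm (fwd_diff n (deriv f) w - (deriv ^^ n) (deriv f) w) \<le> real n * B"
    proof (rule Suc.IH)
      fix x assume x: "norm (x - w) \<le> real n"
      have "norm (x - z) \<le> norm (x - w) + norm (w - z)" using norm_triangle_ineq[of "x - w" "w - z"] by simp
      then have "norm (x - z) \<le> real (Suc n)" using x w by (simp add: dist_norm norm_minus_commute)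
      then show "norm ((deriv ^^ Suc n) (deriv f) x) \<le> B"
        using Suc.prems(2) by (simp only: D)
    qed (rule entire_deriv(1)[OF hol])
    moreover have "norm ((deriv ^^ Suc n) f w - ?c) \<le> B * norm (w - z)"
    proof (rule entire_diff_bound[OF entire_deriv(2)[OF hol], of "cball z 1"])
      fix x assume "x \<in> cball z 1"
      then have "norm (x - z) \<le> 1" by (simp add: dist_norm norm_minus_commute)
      also have "1 \<le> real (Suc n)" by simp
      finally show "norm (deriv ((deriv ^^ Suc n) f) x) \<le> B" using Suc.prems(2)[of x] by simp
    qed (use w in auto)
    moreover have "B * norm (w - z) \<le> B"
    proof -
      have "norm ((deriv ^^ Suc (Suc n)) f z) \<le> B" by (rule Suc.prems(2)) simp
      then have "B \<ge> 0" using norm_ge_zero order_trans by blast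
      then show ?thesis using w by (simp add: dist_norm norm_minus_commute mult_left_le)
    qed
    ultimately show ?thesis
      using norm_triangle_ineq[of "fwd_diff n (deriv f) w - (deriv ^^ Suc n) f w" "(deriv ^^ Suc n) f w - ?c"]
      by (simp only: D) (simp add: algebra_simps)
  qed
  \<comment> \<open>Subtracting the linear function \<open>?c * w\<close> turns the mean value
    inequality for the increment into a bound on its deviation from \<open>?c\<close>.\<close>
  have "norm ((fwd_diff n f (z + 1) - ?c * (z + 1)) - (fwd_diff n f z - ?c * z)) \<le> real (Suc n) * B * norm (z + 1 - z)"
  proof (rule field_differentiable_bound[of "cball z 1" _ "\<lambda>w. fwd_diff n (deriv f) w - ?c"])
    fix w
    have "((\<lambda>w. fwd_diff n f w - ?c * w) has_field_derivative fwd_diff n (deriv f) w - ?c) (at w)"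
      by (auto intro!: derivative_eq_intros has_field_derivative_fwd_diff[OF hol])
    then show "((\<lambda>w. fwd_diff n f w - ?c * w) has_field_derivative fwd_diff n (deriv f) w - ?c) (at w within cball z 1)"
      by (rule has_field_derivative_at_within)
  qed (use bd in \<open>auto simp: dist_norm\<close>)
  then show ?case by (simp add: algebra_simps)
qed

lemma superpoly_nonzero:
  assumes "superpoly f"
  obtains z where "f z \<noteq> 0"
proof -
  have "\<forall>\<^sub>F r in at_top. 1 * r ^ 0 \<le> max_mod f r" using assms unfolding superpoly_def by blast
  with eventually_ge_at_top[of 0] have "\<forall>\<^sub>F r in at_top. r \<ge> 0 \<and> 1 \<le> max_mod f r"
    by eventually_elim auto
  then obtain r where r: "r \<ge> 0" "1 \<le> max_mod f r"
    using eventually_happens[of _ "at_top :: real filter"] trivial_limit_at_top_linorder by blast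
  have "\<exists>z. f z \<noteq> 0"
  proof (rule ccontr)
    assume "\<nexists>z. f z \<noteq> 0"
    then have "max_mod f r \<le> 0" using r by (intro max_mod_le) auto
    then show False using r by simp
  qed
  then show ?thesis using that by blast
qed

text \<open>The error is measured against the \<open>n\<close>-th derivative \<open>F\<close>, not
  against \<open>f\<close>: the shift and Cauchy estimates for \<open>F\<close> make
  \<open>deriv F\<close> small compared with \<open>max_mod F r\<close>, so the error is harmless at
  a maximum point of \<open>F\<close>. A bound through \<open>max_mod f r\<close> need not be small
  compared with \<open>max_mod F r\<close>.\<close>

lemma max_mod_fwd_diff_ge:
  assumes g: "growth l f" and sp: "superpoly f" and l: "0 < l" "l < 1" and m: "m \<ge> 1"
  shows "\<forall>\<^sub>F r in at_top. m ^ n * max_mod f r \<le> 2 * r ^ n * max_mod (fwd_diff n f) r"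
proof -
  note hol = growthD[OF g]
  define F where "F = (deriv ^^ n) f"
  have gF: "growth l F" unfolding F_def by (rule growth_higher_deriv[OF g]) (use l in simp)
  note holF = growthD[OF gF]
  obtain z1 where z1: "F z1 \<noteq> 0"
    using superpoly_nonzero superpoly_higher_deriv[OF hol sp] unfolding F_def by blast
  obtain K where K: "K \<ge> 0"
    "\<forall>\<^sub>F r in at_top. \<forall>s. 0 \<le> s \<and> s \<le> 2 * r powr (1 - l) \<longrightarrow> max_mod F (r + s) \<le> K * max_mod F r"
    using max_mod_shift[OF gF l, of z1] z1 by blast
  \<comment> \<open>Ensures \<open>s \<ge> 1\<close>, room for the shift by \<open>n\<close>, and an
    error of at most \<open>max_mod F r / 2\<close>.\<close>
  have "\<forall>\<^sub>F r in at_top. r powr (1 - l) \<ge> 1 + real n + 2 * real n * K" using l by real_asymp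
  with K(2) max_mod_higher_deriv_ge[OF hol sp m, of n] eventually_gt_at_top[of 0]
  show ?thesis
  proof eventually_elim
    case (elim r)
    define s where "s = r powr (1 - l)"
    have s: "s \<ge> 1" "s \<ge> real n" "s \<ge> 2 * real n * K"
      using elim K(1) by (auto simp: s_def intro: order_trans[rotated])
    obtain z where z: "norm z = r" "norm (F z) = max_mod F r"
      using max_mod_attained[OF holF, of r] elim by auto
    have MF: "max_mod F r \<ge> 0" using max_mod_nonneg[OF holF, of r] elim by simp
    have "norm (fwd_diff n f z - (deriv ^^ n) f z) \<le> real n * (K * max_mod F r / s)"
    proof (rule fwd_diff_approx[OF hol])
      fix w assume w: "norm (w - z) \<le> real n"
      then have "norm w \<le> r + real n" using z norm_triangle_ineq2[of w z] by linarith
      then have "norm ((deriv ^^ 1) F w) \<le> fact 1 * max_mod F (r + (real n + s)) / s ^ 1"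
        by (intro higher_deriv_bound[OF holF]) (use s in auto)
      also have "\<dots> \<le> K * max_mod F r / s"
      proof -
        have "max_mod F (r + (real n + s)) \<le> K * max_mod F r"
          using elim s by (auto simp: s_def)
        then show ?thesis using s by (simp add: divide_right_mono)
      qed
      finally show "norm ((deriv ^^ Suc n) f w) \<le> K * max_mod F r / s"
        by (simp add: F_def)
    qed
    also have "\<dots> \<le> max_mod F r / 2"
    proof -
      have "(2 * real n * K) * max_mod F r \<le> s * max_mod F r" using s MF by (intro mult_right_mono) auto
      then show ?thesis using s by (simp add: field_simps)
    qed
    finally have "norm (fwd_diff n f z - F z) \<le> max_mod F r / 2" by (simp add: F_def)
    then have "max_mod F r / 2 \<le> norm (fwd_diff n f z)"
      using z norm_triangle_ineq3[of "fwd_diff n f z" "F z"] by linarith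
    also have "\<dots> \<le> max_mod (fwd_diff n f) r"
      by (rule norm_le_max_mod_sphere[OF fwd_diff_holomorphic[OF hol] z(1)])
    finally have "r ^ n * max_mod F r \<le> r ^ n * (2 * max_mod (fwd_diff n f) r)"
      using elim by (intro mult_left_mono) auto
    moreover have "m ^ n * max_mod f r \<le> r ^ n * max_mod F r" using elim by (simp add: F_def)
    ultimately show ?case by simp
  qed
qed

text \<open>Cauchy's estimates for \<open>f\<close> with radius \<open>s = r powr (1 - l)\<close>:
  each derivative gains a factor \<open>1 / s\<close>, and \<open>max_mod_shift\<close> keeps the
  enlarged circle within a constant factor.\<close>

lemma max_mod_fwd_diff_le:
  assumes g: "growth l f" and sp: "superpoly f" and l: "0 < l" "l < 1"
  obtains K where "K \<ge> 0"
    "\<forall>\<^sub>F r in at_top. max_mod (fwd_diff n f) r \<le> K * r powr (- (real n * (1 - l))) * max_mod f r"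
proof -
  note hol = growthD[OF g]
  obtain z1 where z1: "f z1 \<noteq> 0" using superpoly_nonzero sp by blast
  obtain K where K: "K \<ge> 0"
    "\<forall>\<^sub>F r in at_top. \<forall>s. 0 \<le> s \<and> s \<le> 2 * r powr (1 - l) \<longrightarrow> max_mod f (r + s) \<le> K * max_mod f r"
    using max_mod_shift[OF g l z1] by blast
  define D where "D = fact n * K + real n * (fact (Suc n) * K)"
  have "\<forall>\<^sub>F r in at_top. r powr (1 - l) \<ge> 1 + real n" using l by real_asymp
  with K(2) eventually_gt_at_top[of 0]
  have "\<forall>\<^sub>F r in at_top. max_mod (fwd_diff n f) r \<le> D * r powr (- (real n * (1 - l))) * max_mod f r"
  proof eventually_elim
    case (elim r)
    define s where "s = r powr (1 - l)"
    have s: "s \<ge> 1" "s \<ge> real n" using elim by (auto simp: s_def)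
    have sn: "r powr (- (real n * (1 - l))) = 1 / s ^ n"
      using elim by (simp add: s_def powr_minus powr_powr mult.commute inverse_eq_divide flip: powr_realpow)
    have Mf: "max_mod f r \<ge> 0" using max_mod_nonneg[OF hol, of r] elim by simp
    have KM: "max_mod f (r + (real n + s)) \<le> K * max_mod f r"
      using elim s by (auto simp: s_def)
    show ?case
    proof (rule max_mod_le)
      fix z :: complex assume z: "norm z = r"
      have "norm (fwd_diff n f z - (deriv ^^ n) f z) \<le> real n * (fact (Suc n) * (K * max_mod f r) / s ^ n)"
      proof (rule fwd_diff_approx[OF hol])
        fix w assume w: "norm (w - z) \<le> real n"
        then have "norm w \<le> r + real n" using z norm_triangle_ineq2[of w z] by linarith
        then have "norm ((deriv ^^ Suc n) f w) \<le> fact (Suc n) * max_mod f (r + (real n + s)) / s ^ Suc n"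
          by (intro higher_deriv_bound[OF hol]) (use s in auto)
        also have "\<dots> \<le> fact (Suc n) * (K * max_mod f r) / s ^ n"
          using KM s K(1) Mf by (intro frac_le mult_left_mono) (auto simp: power_increasing)
        finally show "norm ((deriv ^^ Suc n) f w) \<le> fact (Suc n) * (K * max_mod f r) / s ^ n" .
      qed
      moreover have "norm ((deriv ^^ n) f z) \<le> fact n * max_mod f (r + (real n + s)) / s ^ n"
        by (rule higher_deriv_bound[OF hol]) (use s z in auto)
      moreover have "fact n * max_mod f (r + (real n + s)) / s ^ n \<le> fact n * (K * max_mod f r) / s ^ n"
        using KM s by (intro divide_right_mono mult_left_mono) auto
      ultimately have "norm (fwd_diff n f z) \<le> fact n * (K * max_mod f r) / s ^ n
          + real n * (fact (Suc n) * (K * max_mod f r) / s ^ n)"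
        using norm_triangle_ineq2[of "fwd_diff n f z" "(deriv ^^ n) f z"] by linarith
      also have "\<dots> = D * r powr (- (real n * (1 - l))) * max_mod f r"
        unfolding sn D_def by (simp add: add_divide_distrib algebra_simps)
      finally show "norm (fwd_diff n f z) \<le> D * r powr (- (real n * (1 - l))) * max_mod f r" .
    qed (use elim in simp)
  qed
  moreover have "D \<ge> 0" using K(1) by (simp add: D_def)
  ultimately show ?thesis using that by blast
qed

text \<open>The strict inequality leaves room for an \<open>l\<close> strictly between the order and
  \<open>c\<close>, which absorbs the limes superior; the maximum with 0 keeps \<open>l\<close>
  positive.\<close>

lemma entire_order_imp_growth:
  assumes hol: "f holomorphic_on UNIV" and ord: "entire_order f < ereal c" and c: "c > 0"
  obtains l where "0 < l" "l < c" "growth l f"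
proof -
  have "max (entire_order f) (ereal 0) < ereal c" using ord c by simp
  then obtain l where l: "max (entire_order f) (ereal 0) < ereal l" "ereal l < ereal c"
    using ereal_dense2 by blast
  have "\<forall>\<^sub>F r in at_top. ereal (ln (ln (max_mod f r)) / ln r) < ereal l"
    using l(1) unfolding entire_order_def by (intro Limsup_lessD) auto
  with eventually_gt_at_top[of 1] have "\<forall>\<^sub>F r in at_top. max_mod f r \<le> exp (r powr l) \<and> r > 1"
  proof eventually_elim
    case (elim r)
    \<comment> \<open>The iterated logarithm carries information only where
      \<open>max_mod f r > 1\<close>; elsewhere the bound is trivial.\<close>
    have "max_mod f r \<le> exp (r powr l)"
    proof (cases "max_mod f r > 1")
      case True
      then have "ln (ln (max_mod f r)) < l * ln r" using elim by (simp add: field_simps)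
      then have "exp (ln (ln (max_mod f r))) < exp (l * ln r)" by simp
      then have "ln (max_mod f r) < r powr l" using True elim by (simp add: powr_def)
      then have "exp (ln (max_mod f r)) < exp (r powr l)" by simp
      then show ?thesis using True by simp
    next
      case False
      then show ?thesis by (simp add: order_trans[of _ 1])
    qed
    then show ?case using elim by simp
  qed
  then obtain R where R: "\<And>r. r \<ge> R \<Longrightarrow> max_mod f r \<le> exp (r powr l) \<and> r > 1"
    unfolding eventually_at_top_linorder by blast
  have R1: "R > 1" using R[of R] by simp
  \<comment> \<open>The summand 1 serves the region \<open>norm z \<ge> R\<close>, the summand
    \<open>R powr l\<close> the disc inside it.\<close>
  define C where "C = 1 + R powr l"
  have "norm (f z) \<le> exp (C * (1 + norm z) powr l)" for z
  proof -
    have l0: "l \<ge> 0" using l by simp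
    have one: "1 \<le> (1 + norm z) powr l" using l0 by (simp add: ge_one_powr_ge_zero)
    show ?thesis
    proof (cases "norm z \<ge> R")
      case True
      have "norm (f z) \<le> max_mod f (norm z)" by (rule norm_le_max_mod_sphere[OF hol]) simp
      also have "\<dots> \<le> exp (norm z powr l)" using R True by blast
      also have "\<dots> \<le> exp (C * (1 + norm z) powr l)"
      proof -
        have "norm z powr l \<le> 1 * (1 + norm z) powr l" using l0 by (simp add: powr_mono2)
        also have "\<dots> \<le> C * (1 + norm z) powr l" by (intro mult_right_mono) (auto simp: C_def)
        finally show ?thesis by simp
      qed
      finally show ?thesis .
    next
      case False
      then have "norm (f z) \<le> max_mod f R" by (intro norm_le_max_mod[OF hol]) auto
      also have "\<dots> \<le> exp (R powr l)" using R by blast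
      also have "\<dots> \<le> exp (C * (1 + norm z) powr l)"
      proof -
        have "R powr l \<le> C * 1" by (simp add: C_def)
        also have "\<dots> \<le> C * (1 + norm z) powr l" using one by (intro mult_left_mono) (auto simp: C_def)
        finally show ?thesis by simp
      qed
      finally show ?thesis .
    qed
  qed
  moreover have "C \<ge> 0" by (simp add: C_def)
  ultimately have "growth l f" unfolding growth_def using hol by blast
  then show ?thesis using that[of l] l by simp
qed

section \<open>Finite products over zeros\<close>

text \<open>Factors of the form \<open>1 - z / a\<close> equal 1 at the origin, so splitting off
  zeros never changes the value there. The normalizations at 0 below rest on this.\<close>

lemma entire_factor_zero:
  assumes hol: "f holomorphic_on UNIV" and a: "f a = 0" "a \<noteq> 0"
  obtains h where "h holomorphic_on UNIV" "\<And>z. f z = (1 - z / a) * h z"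
proof -
  define k where "k = (\<lambda>z. if z = a then deriv f a else (f z - f a) / (z - a))"
  have "k holomorphic_on UNIV" unfolding k_def by (rule pole_lemma[OF hol]) auto
  then have "(\<lambda>z. - a * k z) holomorphic_on UNIV" by (intro holomorphic_intros)
  moreover have "f z = (1 - z / a) * (- a * k z)" for z
    using a by (auto simp: k_def field_simps)
  ultimately show ?thesis using that by blast
qed

text \<open>On the circle of radius \<open>3 * R\<close> each factor has modulus at least
  \<open>3 - 1 = 2\<close>; the maximum principle carries the resulting estimate inwards.\<close>

lemma cofactor_bound:
  assumes f: "f holomorphic_on UNIV" and h: "h holomorphic_on UNIV"
    and J: "finite J" "\<And>k. k \<in> J \<Longrightarrow> b k \<noteq> 0 \<and> norm (b k) \<le> R" and R: "R > 0"
    and fac: "\<And>z. f z = (\<Prod>k\<in>J. 1 - z / b k) * h z" and z: "norm z \<le> 3 * R"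
  shows "norm (h z) * 2 ^ card J \<le> max_mod f (3 * R)"
proof -
  have hR: "max_mod h (3 * R) \<le> max_mod f (3 * R) / 2 ^ card J"
  proof (rule max_mod_le)
    fix w :: complex assume w: "norm w = 3 * R"
    have "2 ^ card J = (\<Prod>k\<in>J. 2::real)" by simp
    also have "\<dots> \<le> (\<Prod>k\<in>J. norm (1 - w / b k))"
    proof (rule prod_mono)
      fix k assume k: "k \<in> J"
      have "3 \<le> norm (w / b k)" using J(2)[OF k] w by (simp add: norm_divide field_simps)
      then show "0 \<le> (2::real) \<and> 2 \<le> norm (1 - w / b k)"
        using norm_triangle_ineq3[of 1 "w / b k"] by simp
    qed
    finally have "2 ^ card J * norm (h w) \<le> norm (f w)"
      by (simp add: fac[of w] norm_mult mult_right_mono flip: prod_norm)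
    also have "\<dots> \<le> max_mod f (3 * R)" by (rule norm_le_max_mod_sphere[OF f w])
    finally show "norm (h w) \<le> max_mod f (3 * R) / 2 ^ card J" by (simp add: field_simps)
  qed (use R in simp)
  have hz: "norm (h z) \<le> max_mod h (3 * R)" by (rule norm_le_max_mod[OF h z])
  from mult_right_mono[OF hz, of "2 ^ card J"]
  have "norm (h z) * 2 ^ card J \<le> max_mod h (3 * R) * 2 ^ card J" by simp
  also have "\<dots> \<le> max_mod f (3 * R)" using hR by (simp add: field_simps)
  finally show ?thesis .
qed

text \<open>A substitute for Jensen's formula: the cofactor agrees with \<open>f\<close> at the
  origin.\<close>

lemma zero_count:
  assumes f: "f holomorphic_on UNIV" and h: "h holomorphic_on UNIV"
    and J: "finite J" "\<And>k. k \<in> J \<Longrightarrow> b k \<noteq> 0 \<and> norm (b k) \<le> R" and R: "R > 0"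
    and fac: "\<And>z. f z = (\<Prod>k\<in>J. 1 - z / b k) * h z"
  shows "norm (f 0) * 2 ^ card J \<le> max_mod f (3 * R)"
  using cofactor_bound[OF assms, of 0] R fac[of 0] by simp

text \<open>By \<open>zero_count\<close> the number of factors that can be split off is bounded, so
  a longest factorization exists; a zero of its cofactor in the disc would lengthen it.
  Multiplicities appear as repetitions in \<open>b\<close>.\<close>

lemma zero_factorization:
  assumes f: "f holomorphic_on UNIV" and f0: "f 0 \<noteq> 0" and R: "R > 0"
  obtains N :: nat and b h where "h holomorphic_on UNIV" "\<And>k. k < N \<Longrightarrow> b k \<noteq> 0 \<and> norm (b k) \<le> R"
    "\<And>z. f z = (\<Prod>k<N. 1 - z / b k) * h z" "\<And>z. norm z \<le> R \<Longrightarrow> h z \<noteq> 0"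
proof -
  define P where "P = (\<lambda>N::nat. \<exists>b h. h holomorphic_on UNIV \<and> (\<forall>k<N. b k \<noteq> 0 \<and> norm (b k) \<le> R) \<and>
    (\<forall>z. f z = (\<Prod>k<N. 1 - z / b k) * h z))"
  have P0: "P 0" unfolding P_def using f by auto
  obtain M :: nat where M: "max_mod f (3 * R) / norm (f 0) < 2 ^ M"
    using real_arch_pow[of 2] by auto
  have bd: "N \<le> M" if PN: "P N" for N
  proof -
    obtain b h where bh: "h holomorphic_on UNIV" "\<And>k. k < N \<Longrightarrow> b k \<noteq> 0 \<and> norm (b k) \<le> R"
      "\<And>z. f z = (\<Prod>k<N. 1 - z / b k) * h z" using PN unfolding P_def by blast
    have "norm (f 0) * 2 ^ card {..<N} \<le> max_mod f (3 * R)"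
      by (rule zero_count[OF f bh(1) _ _ R bh(3)]) (use bh(2) in auto)
    then have "2 ^ N \<le> max_mod f (3 * R) / norm (f 0)" using f0 by (simp add: field_simps)
    then have "(2::real) ^ N < 2 ^ M" using M by linarith
    then show ?thesis by simp
  qed
  define N where "N = Greatest P"
  have PN: "P N" unfolding N_def by (rule GreatestI_nat[where P = P, OF P0 bd])
  have PS: "\<not> P (Suc N)"
  proof
    assume "P (Suc N)"
    then have "Suc N \<le> N" unfolding N_def by (rule Greatest_le_nat[where P = P, OF _ bd])
    then show False by simp
  qed
  obtain b h where bh: "h holomorphic_on UNIV" "\<And>k. k < N \<Longrightarrow> b k \<noteq> 0 \<and> norm (b k) \<le> R"
      "\<And>z. f z = (\<Prod>k<N. 1 - z / b k) * h z" using PN unfolding P_def by blast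
  have "h z \<noteq> 0" if z: "norm z \<le> R" for z
  proof
    assume hz: "h z = 0"
    have "h 0 = f 0" using bh(3)[of 0] by simp
    then have "z \<noteq> 0" using hz f0 by auto
    then obtain k where k: "k holomorphic_on UNIV" "\<And>w. h w = (1 - w / z) * k w"
      using entire_factor_zero[OF bh(1) hz] by blast
    have "P (Suc N)" unfolding P_def
    proof (intro exI conjI allI impI)
      show "k holomorphic_on UNIV" by (rule k(1))
      fix i assume "i < Suc N"
      then show "(b(N := z)) i \<noteq> 0" "norm ((b(N := z)) i) \<le> R"
        using bh(2)[of i] z \<open>z \<noteq> 0\<close> by (auto simp: less_Suc_eq)
    next
      fix w show "f w = (\<Prod>i<Suc N. 1 - w / (b(N := z)) i) * k w"
        using bh(3)[of w] k(2)[of w] by (simp add: algebra_simps)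
    qed
    then show False using PS by contradiction
  qed
  then show ?thesis using that bh by blast
qed

text \<open>Borel--Caratheodory: Schwarz's lemma is applied to \<open>v / (2 * B - v)\<close> where \<open>v\<close> is the
  logarithm of \<open>u\<close> that vanishes at \<open>0\<close>.\<close>

lemma zero_free_bound:
  assumes u: "u holomorphic_on ball 0 R" and nz: "\<And>z. norm z < R \<Longrightarrow> u z \<noteq> 0" and u0: "u 0 = 1"
    and B: "\<And>z. norm z < R \<Longrightarrow> norm (u z) < exp B" and R: "R > 0" and z: "norm z \<le> R / 2"
  shows "\<bar>ln (norm (u z))\<bar> \<le> 4 * B * norm z / R"
proof -
  have "B > 0" using B[of 0] u0 R by simp
  obtain v0 where v0: "v0 holomorphic_on ball 0 R" "\<And>z. z \<in> ball 0 R \<Longrightarrow> u z = exp (v0 z)"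
    using contractible_imp_holomorphic_log[OF u] nz by (auto simp: convex_imp_contractible)
  define v where "v = (\<lambda>z. v0 z - v0 0)"
  have v: "v holomorphic_on ball 0 R" unfolding v_def by (intro holomorphic_intros v0)
  \<comment> \<open>Thus \<open>v0 0\<close> is a multiple of \<open>2 * pi * \<i>\<close>, and
    subtracting it leaves the exponential unchanged.\<close>
  have e0: "exp (v0 0) = 1" using v0(2)[of 0] u0 R by simp
  have uv: "u z = exp (v z)" if "norm z < R" for z
    using v0(2)[of z] that e0 by (simp add: v_def exp_diff)
  have Rv: "Re (v z) < B" if "norm z < R" for z
    using B[OF that] uv[OF that] by simp
  \<comment> \<open>Points with real part below \<open>B\<close> lie nearer to 0 than to
    \<open>2 * B\<close>.\<close>
  have lt: "norm (v z) < norm (2 * B - v z)" if "norm z < R" for z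
  proof -
    have "(norm (2 * B - v z))\<^sup>2 - (norm (v z))\<^sup>2 = 4 * B * (B - Re (v z))"
      unfolding cmod_power2 by (simp add: power2_eq_square algebra_simps)
    moreover have "4 * B * (B - Re (v z)) > 0" using Rv[OF that] \<open>B > 0\<close> by simp
    ultimately show ?thesis by (intro power2_less_imp_less[of "norm (v z)"]) auto
  qed
  define w where "w = (\<lambda>\<zeta>::complex. v (R * \<zeta>) / (2 * B - v (R * \<zeta>)))"
  have inR: "norm (of_real R * \<zeta>) < R" if "norm \<zeta> < 1" for \<zeta> :: complex
    using that R by (simp add: norm_mult)
  have vR: "(\<lambda>\<zeta>::complex. v (R * \<zeta>)) holomorphic_on ball 0 1"
  proof -
    have "(v \<circ> (\<lambda>\<zeta>::complex. R * \<zeta>)) holomorphic_on ball 0 1"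
      by (rule holomorphic_on_compose_gen[OF _ v]) (use inR in \<open>auto intro!: holomorphic_intros\<close>)
    then show ?thesis by (simp add: o_def)
  qed
  have nz2: "2 * B - v (R * \<zeta>) \<noteq> 0" if "norm \<zeta> < 1" for \<zeta> :: complex
    using lt[OF inR[OF that]] by auto
  have "w holomorphic_on ball 0 1"
    unfolding w_def by (rule holomorphic_on_divide[OF vR]) (use nz2 vR in \<open>auto intro!: holomorphic_on_diff\<close>)
  moreover have "w 0 = 0" by (simp add: w_def v_def)
  moreover have "norm (w \<zeta>) < 1" if "norm \<zeta> < 1" for \<zeta>
    using lt[OF inR[OF that]] nz2[OF that] by (simp add: w_def norm_divide field_simps)
  moreover define \<zeta> where "\<zeta> = z / R"
  have \<zeta>: "norm \<zeta> \<le> 1 / 2" "R * \<zeta> = z" "norm \<zeta> = norm z / R"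
    using z R by (auto simp: \<zeta>_def norm_divide field_simps)
  moreover have "norm \<zeta> < 1" using \<zeta>(1) by linarith
  ultimately have W: "norm (w \<zeta>) \<le> norm \<zeta>" using Schwarz_Lemma(1)[of w \<zeta>] by blast
  define x where "x = w \<zeta>"
  have W2: "norm x \<le> 1 / 2" using W \<zeta>(1) unfolding x_def by linarith
  \<comment> \<open>This solves \<open>x = v z / (2 * B - v z)\<close> for \<open>v z\<close>; since
    \<open>norm x \<le> 1 / 2\<close>, dividing by \<open>1 + x\<close> costs at most a factor
    2.\<close>
  have "v z * (1 + x) = 2 * B * x"
    using nz2[of \<zeta>] \<zeta> by (simp add: x_def w_def field_simps)
  then have "norm (v z) * norm (1 + x) = 2 * B * norm x"
    using \<open>B > 0\<close> by (metis (no_types, lifting) norm_mult norm_of_real abs_of_pos mult.assoc norm_numeral of_real_mult of_real_numeral)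
  moreover have "1 / 2 \<le> norm (1 + x)"
    using W2 norm_triangle_ineq3[of 1 "- x"] by simp
  ultimately have "norm (v z) * (1 / 2) \<le> 2 * B * norm x"
    by (metis mult_left_mono norm_ge_zero)
  also have "\<dots> \<le> 2 * B * norm \<zeta>" using W \<open>B > 0\<close> by (simp add: x_def)
  finally have "norm (v z) \<le> 4 * B * norm z / R" by (simp add: \<zeta>)
  moreover have "ln (norm (u z)) = Re (v z)" using uv[of z] z R by simp
  ultimately show ?thesis using abs_Re_le_cmod[of "v z"] by linarith
qed

text \<open>In increasing order, the \<open>j\<close>-th value has at least \<open>j\<close> values
  up to it, so the counting bound yields \<open>j / K \<le> x powr l\<close> there. The induction
  removes the largest value. The term for \<open>j = 0\<close> is 0, as
  \<open>0 powr _ = 0\<close>.\<close>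

lemma sum_powr_le:
  fixes x :: "'a \<Rightarrow> real"
  assumes "finite J" "\<And>k. k \<in> J \<Longrightarrow> x k \<ge> 1" and K: "K > 0" and l: "0 < l" "0 < \<mu>"
    and count: "\<And>t. t \<ge> 1 \<Longrightarrow> real (card {k \<in> J. x k \<le> t}) \<le> K * t powr l"
  shows "(\<Sum>k\<in>J. x k powr (- \<mu>)) \<le> (\<Sum>j<Suc (card J). (real j / K) powr (- (\<mu> / l)))"
  using assms(1,2) count
proof (induction "card J" arbitrary: J)
  case 0
  then show ?case by simp
next
  case (Suc n)
  have ne: "J \<noteq> {}" using Suc.hyps(2) by auto
  obtain m where m: "m \<in> J" "\<And>k. k \<in> J \<Longrightarrow> x k \<le> x m"
    using Max_in[of "x ` J"] Max_ge[of "x ` J"] Suc.prems(1) ne by (metis (no_types) finite_imageI image_iff image_is_empty)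
  have x1: "x m \<ge> 1" using Suc.prems(2) m(1) by blast
  have n: "n = card (J - {m})" using Suc.hyps(2) m(1) Suc.prems(1) by simp
  have "{k \<in> J. x k \<le> x m} = J" using m(2) by auto
  then have "real (card J) \<le> K * x m powr l" using Suc.prems(3)[OF x1] by simp
  then have "real (card J) / K \<le> x m powr l" using K by (simp add: field_simps)
  moreover have "real (card J) / K > 0" using Suc.hyps(2) K by simp
  ultimately have "(x m powr l) powr (- (\<mu> / l)) \<le> (real (card J) / K) powr (- (\<mu> / l))"
    using l by (intro powr_mono2') auto
  then have t: "x m powr (- \<mu>) \<le> (real (card J) / K) powr (- (\<mu> / l))"
    using l by (simp add: powr_powr)
  have "(\<Sum>k\<in>J - {m}. x k powr (- \<mu>)) \<le> (\<Sum>j<Suc (card (J - {m})). (real j / K) powr (- (\<mu> / l)))"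
  proof (rule Suc.hyps(1)[OF n])
    fix t :: real assume t: "t \<ge> 1"
    have "card {k \<in> J - {m}. x k \<le> t} \<le> card {k \<in> J. x k \<le> t}"
      using Suc.prems(1) by (intro card_mono) auto
    then show "real (card {k \<in> J - {m}. x k \<le> t}) \<le> K * t powr l"
      using Suc.prems(3)[OF t] by linarith
  qed (use Suc.prems in auto)
  moreover have "(\<Sum>k\<in>J. x k powr (- \<mu>)) = x m powr (- \<mu>) + (\<Sum>k\<in>J - {m}. x k powr (- \<mu>))"
    by (rule sum.remove[OF Suc.prems(1) m(1)])
  ultimately show ?case using t by (simp add: Suc.hyps(2)[symmetric] n[symmetric])
qed

text \<open>Serves to bound a product of factors \<open>1 + r / a k\<close> by the exponential of a
  sum of \<open>\<mu>\<close>-th powers.\<close>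

lemma one_plus_le_exp_powr:
  assumes x: "x \<ge> (0::real)" and \<mu>: "0 < \<mu>" "\<mu> \<le> 1"
  shows "1 + x \<le> exp ((2 / \<mu> + 1) * x powr \<mu>)"
proof (cases "x \<le> 1")
  case True
  have "x \<le> x powr \<mu>"
    using powr_mono'[of \<mu> 1 x] True x \<mu> by auto
  also have "\<dots> \<le> (2 / \<mu> + 1) * x powr \<mu>" using \<mu> by (simp add: algebra_simps)
  finally show ?thesis using exp_ge_add_one_self[of x] by (meson exp_le_cancel_iff order_trans)
next
  case False
  have "\<mu> * ln (2 * x) \<le> (2 * x) powr \<mu>"
    using False ln_le_minus_one[of "(2 * x) powr \<mu>"] by (simp add: ln_powr)
  also have "\<dots> = 2 powr \<mu> * x powr \<mu>" using x by (simp add: powr_mult)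
  also have "\<dots> \<le> 2 * x powr \<mu>"
    using powr_mono[of \<mu> 1 2] \<mu> by (intro mult_right_mono) auto
  finally have "ln (2 * x) \<le> 2 / \<mu> * x powr \<mu>" using \<mu> by (simp add: field_simps)
  also have "\<dots> \<le> (2 / \<mu> + 1) * x powr \<mu>" by (intro mult_right_mono) auto
  finally have "2 * x \<le> exp ((2 / \<mu> + 1) * x powr \<mu>)"
    using False by (subst ln_le_cancel_iff[symmetric]) auto
  then show ?thesis using False by simp
qed

text \<open>The order of quantifiers is the point: \<open>C\<close> depends on the counting
  constants and on \<open>\<delta>\<close>, but not on the finite family. The dominating series
  converges because \<open>\<mu> / l > 1\<close>.\<close>

lemma prod_one_plus_le:
  assumes K: "K > 0" and l: "0 < l" "l < \<mu>" "\<mu> \<le> 1" and \<delta>: "\<delta> > 0"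
  obtains C where "C \<ge> 0" "\<forall>(J::nat set) (a::nat \<Rightarrow> real) r. finite J \<longrightarrow> (\<forall>k\<in>J. a k \<ge> \<delta>) \<longrightarrow>
      (\<forall>t\<ge>0. real (card {k \<in> J. a k \<le> t}) \<le> K * (1 + t) powr l) \<longrightarrow> r \<ge> 0 \<longrightarrow>
      (\<Prod>k\<in>J. 1 + r / a k) \<le> exp (C * r powr \<mu>)"
proof -
  \<comment> \<open>Chosen so that \<open>a k \<ge> \<delta>\<close> implies
    \<open>d * (1 + a k) \<le> a k\<close>. The values \<open>1 + a k\<close> are at least 1, as
    \<open>sum_powr_le\<close> demands.\<close>
  define d where "d = \<delta> / (1 + \<delta>)"
  have d: "d > 0" using \<delta> by (simp add: d_def)
  define S where "S = (\<Sum>j. (real j / K) powr (- (\<mu> / l)))"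
  have "summable (\<lambda>j. real j powr (- (\<mu> / l)))"
    unfolding summable_real_powr_iff using l by (simp add: field_simps)
  then have "summable (\<lambda>j. real j powr (- (\<mu> / l)) * (1 / K) powr (- (\<mu> / l)))" by (rule summable_mult2)
  then have sm: "summable (\<lambda>j. (real j / K) powr (- (\<mu> / l)))"
    using K by (simp add: powr_mult[symmetric])
  define C where "C = (2 / \<mu> + 1) * d powr (- \<mu>) * S"
  have "S \<ge> 0" unfolding S_def by (rule suminf_nonneg[OF sm]) simp
  then have C0: "C \<ge> 0" using l by (simp add: C_def)
  have "(\<Prod>k\<in>J. 1 + r / a k) \<le> exp (C * r powr \<mu>)"
    if J: "finite J" "\<And>k. k \<in> J \<Longrightarrow> a k \<ge> \<delta>"
      "\<And>t. t \<ge> 0 \<Longrightarrow> real (card {k \<in> J. a k \<le> t}) \<le> K * (1 + t) powr l" and r: "r \<ge> 0"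
    for J :: "nat set" and a :: "nat \<Rightarrow> real" and r
  proof -
    have S: "(\<Sum>k\<in>J. (1 + a k) powr (- \<mu>)) \<le> S"
    proof -
      have "(\<Sum>k\<in>J. (1 + a k) powr (- \<mu>)) \<le> (\<Sum>j<Suc (card J). (real j / K) powr (- (\<mu> / l)))"
      proof (rule sum_powr_le[OF J(1) _ K])
        fix t :: real assume "t \<ge> 1"
        then show "real (card {k \<in> J. 1 + a k \<le> t}) \<le> K * t powr l"
          using J(3)[of "t - 1"] by (simp add: algebra_simps)
      qed (use l J(2) \<delta> in \<open>auto intro: order_trans[OF less_imp_le]\<close>)
      also have "\<dots> \<le> S" unfolding S_def by (rule sum_le_suminf[OF sm]) auto
      finally show ?thesis .
    qed
    have "(\<Prod>k\<in>J. 1 + r / a k) \<le> (\<Prod>k\<in>J. exp ((2 / \<mu> + 1) * (d powr (- \<mu>) * r powr \<mu> * (1 + a k) powr (- \<mu>))))"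
    proof (rule prod_mono, intro conjI)
      fix k assume k: "k \<in> J"
      have ak: "a k \<ge> \<delta>" "a k > 0" using J(2)[OF k] \<delta> by auto
      show "0 \<le> 1 + r / a k" using ak r by simp
      have "d * (1 + a k) \<le> a k" using ak \<delta> by (simp add: d_def field_simps)
      then have "r / a k \<le> r / (d * (1 + a k))" using r d ak by (intro divide_left_mono) auto
      then have "1 + r / a k \<le> 1 + r / (d * (1 + a k))" by simp
      also have "\<dots> \<le> exp ((2 / \<mu> + 1) * (r / (d * (1 + a k))) powr \<mu>)"
        using r d ak l by (intro one_plus_le_exp_powr) auto
      also have "(r / (d * (1 + a k))) powr \<mu> = d powr (- \<mu>) * r powr \<mu> * (1 + a k) powr (- \<mu>)"
        unfolding powr_divide powr_mult powr_minus using d by (simp add: divide_simps)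
      finally show "1 + r / a k \<le> exp ((2 / \<mu> + 1) * (d powr (- \<mu>) * r powr \<mu> * (1 + a k) powr (- \<mu>)))" .
    qed
    also have "\<dots> = exp ((2 / \<mu> + 1) * d powr (- \<mu>) * r powr \<mu> * (\<Sum>k\<in>J. (1 + a k) powr (- \<mu>)))"
      by (simp add: exp_sum[OF J(1), symmetric] sum_distrib_left mult_ac)
    also have "\<dots> \<le> exp ((2 / \<mu> + 1) * d powr (- \<mu>) * r powr \<mu> * S)"
      unfolding exp_le_cancel_iff using S l by (intro mult_left_mono) auto
    also have "(2 / \<mu> + 1) * d powr (- \<mu>) * r powr \<mu> * S = C * r powr \<mu>" by (simp add: C_def)
    finally show ?thesis .
  qed
  then show ?thesis by (intro that[OF C0]) blast
qed

section \<open>Minimum modulus\<close>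

lemma abs_ln_bound:
  fixes x c :: real
  assumes "x > 0" "\<bar>ln x\<bar> \<le> ln c" "c > 0" shows "x \<le> c" "1 \<le> c * x"
proof -
  have "ln x \<le> ln c" using assms(2) by linarith
  then show "x \<le> c" using assms(1,3) by simp
  have "0 \<le> ln (c * x)" using assms by (simp add: ln_mult)
  then show "1 \<le> c * x" using assms by (simp add: ln_ge_zero_iff)
qed

text \<open>Although no growth bound for \<open>H = F / g\<close> is known a priori, on each disc \<open>H\<close> is
  comparable to a finite product over zeros of \<open>H\<close>. These are zeros of \<open>F\<close>, which gives
  bounds on the product that do not depend on the disc.\<close>

lemma quotient_model:
  assumes F: "growth l F" and g: "growth l g" and H: "H holomorphic_on UNIV"
    and eq: "\<And>z. F z = H z * g z" and one: "F 0 = 1" "g 0 = 1" "H 0 = 1"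
    and l: "0 < l" "l < \<mu>" "\<mu> < 1"
  obtains C where "C \<ge> 0" "\<forall>T>0. \<exists>(N::nat) b. (\<forall>k<N. b k \<noteq> (0::complex)) \<and>
     (\<forall>r\<ge>0. (\<Prod>k<N. 1 + r / norm (b k)) \<le> exp (C * r powr \<mu>)) \<and>
     (\<forall>z. norm z \<le> T \<longrightarrow> (\<Prod>k<N. norm (1 - z / b k)) \<le> 2 * norm (H z) \<and>
        norm (H z) \<le> 2 * (\<Prod>k<N. norm (1 - z / b k)))"
proof -
  note hF = growthD[OF F] and hg = growthD[OF g]
  obtain C1 where C1: "C1 \<ge> 0" "\<And>z. norm (F z) \<le> exp (C1 * (1 + norm z) powr l)"
    using growthE[OF F] by blast
  obtain C2 where C2: "C2 \<ge> 0" "\<And>z. norm (g z) \<le> exp (C2 * (1 + norm z) powr l)"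
    using growthE[OF g] by blast
  have MF: "max_mod F r \<le> exp (C1 * (1 + r) powr l)" if "r \<ge> 0" for r
    by (rule max_mod_le[OF that]) (use C1 in metis)
  have Mg: "max_mod g r \<le> exp (C2 * (1 + r) powr l)" if "r \<ge> 0" for r
    by (rule max_mod_le[OF that]) (use C2 in metis)
  obtain \<delta> where \<delta>: "\<delta> > 0" "\<And>z. norm z < \<delta> \<Longrightarrow> F z \<noteq> 0"
  proof -
    have "continuous (at 0) F" using entire_continuous[OF hF, of UNIV] continuous_on_eq_continuous_at by blast
    then obtain e where "e > 0" "\<forall>y. dist 0 y < e \<longrightarrow> F y \<noteq> 0"
      using continuous_at_avoid[of 0 F 0] one by auto
    then show ?thesis using that[of e] by (auto simp: dist_norm)
  qed
  \<comment> \<open>Solving \<open>2 ^ card J \<le> exp (C1 * (3 * (1 + t)) powr l)\<close> for the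
    cardinality produces the quotient by \<open>ln 2\<close>; the summand 1 makes \<open>K\<close>
    positive.\<close>
  define K where "K = C1 * 3 powr l / ln 2 + 1"
  have K: "K > 0" using C1 by (simp add: K_def add_nonneg_pos)
  obtain C where C: "C \<ge> 0" "\<forall>(J::nat set) (a::nat \<Rightarrow> real) r. finite J \<longrightarrow> (\<forall>k\<in>J. a k \<ge> \<delta>) \<longrightarrow>
      (\<forall>t\<ge>0. real (card {k \<in> J. a k \<le> t}) \<le> K * (1 + t) powr l) \<longrightarrow> r \<ge> 0 \<longrightarrow>
      (\<Prod>k\<in>J. 1 + r / a k) \<le> exp (C * r powr \<mu>)"
    by (rule prod_one_plus_le[OF K l(1,2) less_imp_le[OF l(3)] \<delta>(1)])
  have "\<exists>(N::nat) b. (\<forall>k<N. b k \<noteq> (0::complex)) \<and>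
     (\<forall>r\<ge>0. (\<Prod>k<N. 1 + r / norm (b k)) \<le> exp (C * r powr \<mu>)) \<and>
     (\<forall>z. norm z \<le> T \<longrightarrow> (\<Prod>k<N. norm (1 - z / b k)) \<le> 2 * norm (H z) \<and>
        norm (H z) \<le> 2 * (\<Prod>k<N. norm (1 - z / b k)))" if T: "T > 0" for T
  proof -
    define D where "D = max C1 C2"
    \<comment> \<open>As \<open>l < 1\<close>, the Borel--Caratheodory bound
      \<open>4 * B * T / R\<close> tends to 0: seen on the fixed disc of radius \<open>T\<close>,
      the zero-free cofactors belonging to a much larger disc are almost constant.\<close>
    have "((\<lambda>R. (1 + 3 * R) powr l / R) \<longlongrightarrow> 0) at_top" "((\<lambda>R::real. 1 / R) \<longlongrightarrow> 0) at_top"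
      using l by real_asymp+
    then have "((\<lambda>R. 4 * T * D * ((1 + 3 * R) powr l / R) + 4 * T * (1 / R)) \<longlongrightarrow> 4 * T * D * 0 + 4 * T * 0) at_top"
      by (intro tendsto_intros)
    then have "\<forall>\<^sub>F R in at_top. 4 * T * D * ((1 + 3 * R) powr l / R) + 4 * T * (1 / R) < ln 2 / 2"
      by (rule order_tendstoD) auto
    with eventually_ge_at_top[of "2 * T"]
    have "\<forall>\<^sub>F R in at_top. R \<ge> 2 * T \<and> 4 * T * D * ((1 + 3 * R) powr l / R) + 4 * T * (1 / R) < ln 2 / 2"
      by eventually_elim auto
    then obtain R where R: "R \<ge> 2 * T" "4 * T * D * ((1 + 3 * R) powr l / R) + 4 * T * (1 / R) < ln 2 / 2"
      unfolding eventually_at_top_linorder by blast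
    have Rp: "R > 0" using R T by simp
    define B where "B = D * (1 + 3 * R) powr l + 1"
    have Bsmall: "4 * B * norm z / R \<le> ln 2 / 2" if "norm z \<le> T" for z :: complex
    proof -
      have "B \<ge> 0" using C1 C2 by (simp add: B_def D_def)
      then have "4 * B * norm z / R \<le> 4 * B * T / R"
        using that Rp by (intro divide_right_mono mult_left_mono) auto
      also have "\<dots> = 4 * T * D * ((1 + 3 * R) powr l / R) + 4 * T * (1 / R)"
        using Rp by (simp add: B_def field_simps)
      finally show ?thesis using R by simp
    qed
    have BF: "max_mod F (3 * R) < exp B"
    proof -
      have "max_mod F (3 * R) \<le> exp (C1 * (1 + 3 * R) powr l)" using MF Rp by simp
      also have "\<dots> \<le> exp (D * (1 + 3 * R) powr l)" by (simp add: D_def mult_right_mono)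
      also have "\<dots> < exp B" by (simp add: B_def)
      finally show ?thesis .
    qed
    have Bg: "max_mod g (3 * R) < exp B"
    proof -
      have "max_mod g (3 * R) \<le> exp (C2 * (1 + 3 * R) powr l)" using Mg Rp by simp
      also have "\<dots> \<le> exp (D * (1 + 3 * R) powr l)" by (simp add: D_def mult_right_mono)
      also have "\<dots> < exp B" by (simp add: B_def)
      finally show ?thesis .
    qed
    obtain N :: nat and b h where b: "h holomorphic_on UNIV" "\<And>k. k < N \<Longrightarrow> b k \<noteq> 0 \<and> norm (b k) \<le> R"
      "\<And>z. H z = (\<Prod>k<N. 1 - z / b k) * h z" "\<And>z. norm z \<le> R \<Longrightarrow> h z \<noteq> 0"
      using zero_factorization[OF H _ Rp] one by (metis zero_neq_one)
    obtain L :: nat and d u where d: "u holomorphic_on UNIV" "\<And>k. k < L \<Longrightarrow> d k \<noteq> 0 \<and> norm (d k) \<le> R"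
      "\<And>z. g z = (\<Prod>k<L. 1 - z / d k) * u z" "\<And>z. norm z \<le> R \<Longrightarrow> u z \<noteq> 0"
      using zero_factorization[OF hg _ Rp] one by (metis zero_neq_one)
    have u0: "u 0 = 1" "h 0 = 1" using b(3)[of 0] d(3)[of 0] one by auto
    have hu: "(\<lambda>z. h z * u z) holomorphic_on UNIV" by (intro holomorphic_on_mult b(1) d(1))
    have uB: "norm (u z) < exp B" if "norm z < R" for z
    proof -
      have "norm (u z) * 2 ^ card {..<L} \<le> max_mod g (3 * R)"
        by (rule cofactor_bound[OF hg d(1) _ _ Rp d(3)]) (use d(2) that Rp in auto)
      moreover have "norm (u z) * 1 \<le> norm (u z) * 2 ^ card {..<L}" by (intro mult_left_mono) auto
      ultimately show ?thesis using Bg by linarith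
    qed
    \<comment> \<open>The product \<open>h * u\<close> is the cofactor of \<open>F\<close> after the
      chosen zeros of both \<open>H\<close> and \<open>g\<close> are split off; the disjoint sum
      indexes the two lists together.\<close>
    have huB: "norm (h z * u z) < exp B" if "norm z < R" for z
    proof -
      define e where "e = case_sum b d"
      let ?J = "{..<N} <+> {..<L}"
      have "norm (h z * u z) * 2 ^ card ?J \<le> max_mod F (3 * R)"
      proof (rule cofactor_bound[OF hF hu _ _ Rp, where b = e])
        show "F z = (\<Prod>k\<in>?J. 1 - z / e k) * (h z * u z)" for z
          by (simp add: eq b(3)[of z] d(3)[of z] prod.Plus e_def mult_ac o_def)
      qed (use b(2) d(2) that Rp in \<open>auto simp: e_def\<close>)
      moreover have "norm (h z * u z) * 1 \<le> norm (h z * u z) * 2 ^ card ?J" by (intro mult_left_mono) auto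
      ultimately show ?thesis using BF by linarith
    qed
    \<comment> \<open>There is no direct bound for \<open>h\<close>. Its logarithmic modulus is the
      difference of those of \<open>h * u\<close> and \<open>u\<close>, each of which is at most
      \<open>ln 2 / 2\<close> in absolute value.\<close>
    have h2: "norm (h z) \<le> 2" "1 \<le> 2 * norm (h z)" if z: "norm z \<le> T" for z
    proof -
      have zR: "norm z \<le> R / 2" "norm z \<le> R" using z R T by auto
      have nz: "h z \<noteq> 0" "u z \<noteq> 0" using b(4) d(4) zR by auto
      have "\<bar>ln (norm (u z))\<bar> \<le> 4 * B * norm z / R"
        by (rule zero_free_bound[OF entire_subset[OF d(1)]]) (use d(4) u0 uB Rp zR in auto)
      moreover have "\<bar>ln (norm (h z * u z))\<bar> \<le> 4 * B * norm z / R"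
        by (rule zero_free_bound[OF entire_subset[OF hu]]) (use b(4) d(4) u0 huB Rp zR in auto)
      moreover have "ln (norm (h z * u z)) = ln (norm (h z)) + ln (norm (u z))"
        using nz by (simp add: norm_mult ln_mult)
      ultimately have "\<bar>ln (norm (h z))\<bar> \<le> ln 2" using Bsmall[OF z] by linarith
      then show "norm (h z) \<le> 2" "1 \<le> 2 * norm (h z)" using abs_ln_bound[of "norm (h z)" 2] nz by auto
    qed
    have prodb: "(\<Prod>k<N. 1 + r / norm (b k)) \<le> exp (C * r powr \<mu>)" if r: "r \<ge> 0" for r
    proof (rule C(2)[rule_format])
      fix k assume k: "k \<in> {..<N}"
      have "H (b k) = 0" using b(3)[of "b k"] b(2)[of k] k by auto
      then have "F (b k) = 0" using eq by simp
      then show "\<delta> \<le> norm (b k)" using \<delta>(2) not_le by blast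
    next
      fix t :: real assume t: "t \<ge> 0"
      show "real (card {k \<in> {..<N}. norm (b k) \<le> t}) \<le> K * (1 + t) powr l"
      proof (cases "t = 0")
        case True
        then have "{k \<in> {..<N}. norm (b k) \<le> t} = {}" using b(2) by auto
        then show ?thesis using K by (simp only: card.empty) simp
      next
        case False
        let ?J = "{k \<in> {..<N}. norm (b k) \<le> t}"
        have tp: "t > 0" using t False by simp
        \<comment> \<open>Only the zeros of modulus at most \<open>t\<close> are to be counted, so
          all other factors join the cofactor.\<close>
        define v where "v = (\<lambda>z. (\<Prod>k\<in>{..<N} - ?J. 1 - z / b k) * (h z * g z))"
        have v: "v holomorphic_on UNIV"
          unfolding v_def by (intro holomorphic_on_mult holomorphic_on_prod b(1) hg) (use b(2) in \<open>auto intro!: holomorphic_intros\<close>)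
        have "norm (F 0) * 2 ^ card ?J \<le> max_mod F (3 * t)"
        proof (rule zero_count[OF hF v _ _ tp])
          fix z
          have "(\<Prod>k<N. 1 - z / b k) = (\<Prod>k\<in>{..<N} - ?J. 1 - z / b k) * (\<Prod>k\<in>?J. 1 - z / b k)"
            by (rule prod.subset_diff) auto
          then show "F z = (\<Prod>k\<in>?J. 1 - z / b k) * v z"
            by (simp add: eq b(3)[of z] v_def mult_ac)
        qed (use b(2) in auto)
        also have "\<dots> \<le> exp (C1 * (1 + 3 * t) powr l)" using MF tp by simp
        also have "\<dots> \<le> exp (C1 * (3 * (1 + t)) powr l)"
          unfolding exp_le_cancel_iff using C1 tp l by (intro mult_left_mono powr_mono2) auto
        finally have "ln (2 ^ card ?J) \<le> C1 * (3 * (1 + t)) powr l"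
          using one by (subst ln_exp[symmetric], subst ln_le_cancel_iff) auto
        then have "real (card ?J) \<le> C1 * (3 * (1 + t)) powr l / ln 2"
          by (simp add: ln_realpow field_simps)
        also have "(3 * (1 + t)) powr l = 3 powr l * (1 + t) powr l" by (rule powr_mult)
        also have "C1 * (3 powr l * (1 + t) powr l) / ln 2 \<le> K * (1 + t) powr l"
          by (simp add: K_def algebra_simps)
        finally show ?thesis .
      qed
    qed (use r in auto)
    have "(\<Prod>k<N. norm (1 - z / b k)) \<le> 2 * norm (H z) \<and> norm (H z) \<le> 2 * (\<Prod>k<N. norm (1 - z / b k))"
      if z: "norm z \<le> T" for z
    proof -
      define p where "p = (\<Prod>k<N. norm (1 - z / b k))"
      have p: "p \<ge> 0" unfolding p_def by (rule prod_nonneg) auto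
      have Hp: "norm (H z) = p * norm (h z)" by (simp add: b(3)[of z] norm_mult p_def prod_norm)
      have "p * norm (h z) \<le> p * 2" "p * 1 \<le> p * (2 * norm (h z))"
        using h2[OF z] p by (intro mult_left_mono; simp)+
      then show ?thesis unfolding p_def[symmetric] Hp by (simp add: mult_ac)
    qed
    then show ?thesis using b(2) prodb by blast
  qed
  then show ?thesis by (intro that[OF C(1)] allI impI)
qed

text \<open>For \<open>\<gamma> < 1\<close> the power maps the right half plane into a sector of
  opening less than \<open>pi\<close>, which makes
  \<open>exp (- (\<epsilon> * z powr \<gamma>))\<close> a damping factor there.\<close>

lemma Re_powr_ge:
  assumes z: "Re z > 0" and \<gamma>: "0 < \<gamma>" "\<gamma> < 1"
  shows "Re (z powr of_real \<gamma>) \<ge> cos (\<gamma> * pi / 2) * norm z powr \<gamma>"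
proof -
  have z0: "z \<noteq> 0" using z by auto
  have im: "\<bar>Im (Ln z)\<bar> < pi / 2" using Re_Ln_pos_lt[OF z0] z by simp
  have "z powr of_real \<gamma> = exp (of_real \<gamma> * Ln z)" using z0 by (simp add: powr_def)
  then have "Re (z powr of_real \<gamma>) = exp (\<gamma> * ln (norm z)) * cos (\<gamma> * Im (Ln z))"
    using z0 by (simp add: Re_exp)
  also have "exp (\<gamma> * ln (norm z)) = norm z powr \<gamma>" using z0 by (simp add: powr_def)
  finally have e: "Re (z powr of_real \<gamma>) = norm z powr \<gamma> * cos \<bar>\<gamma> * Im (Ln z)\<bar>" by simp
  have "\<bar>\<gamma> * Im (Ln z)\<bar> \<le> \<gamma> * (pi / 2)" using im \<gamma> by (simp add: abs_mult)
  moreover have "\<gamma> * (pi / 2) \<le> pi" using \<gamma> by (simp add: mult_left_le)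
  ultimately have "cos (\<gamma> * (pi / 2)) \<le> cos \<bar>\<gamma> * Im (Ln z)\<bar>" by (intro cos_monotone_0_pi_le) auto
  then show ?thesis unfolding e by (simp add: mult.commute mult_left_mono)
qed

text \<open>Phragmen--Lindelof on a half disc: after the substitution \<open>w = - \<zeta>\<^sup>2\<close>, the polynomial
  with the positive zeros \<open>\<bar>b k\<bar>\<close> has order below one in the right half plane, and on the
  imaginary axis it is dominated by the minimum modulus of \<open>H\<close>.\<close>

lemma min_modulus_bound:
  fixes H :: "complex \<Rightarrow> complex"
  assumes C: "C \<ge> 0" and \<mu>: "0 < \<mu>" "\<mu> < 1 / 2"
    and model: "\<And>T. T > 0 \<Longrightarrow> \<exists>(N::nat) b. (\<forall>k<N. b k \<noteq> (0::complex)) \<and>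
     (\<forall>r\<ge>0. (\<Prod>k<N. 1 + r / norm (b k)) \<le> exp (C * r powr \<mu>)) \<and>
     (\<forall>z. norm z \<le> T \<longrightarrow> (\<Prod>k<N. norm (1 - z / b k)) \<le> 2 * norm (H z) \<and>
        norm (H z) \<le> 2 * (\<Prod>k<N. norm (1 - z / b k)))"
    and A: "A \<ge> 1" and min: "\<And>r. r \<ge> 0 \<Longrightarrow> \<exists>z. norm z = r \<and> norm (H z) \<le> A * (1 + r) ^ m"
  shows "norm (H z) \<le> 4 * A * (1 + sqrt (norm z)) ^ (2 * m)"
proof -
  \<comment> \<open>The midpoint between \<open>2 * \<mu>\<close>, the growth exponent of
    \<open>E\<close> below, and 1, the limit for damping in a half plane.\<close>
  define \<gamma> where "\<gamma> = \<mu> + 1 / 2"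
  have \<gamma>: "0 < \<gamma>" "\<gamma> < 1" "2 * \<mu> < \<gamma>" using \<mu> by (auto simp: \<gamma>_def)
  define c where "c = cos (\<gamma> * pi / 2)"
  have c: "c > 0" unfolding c_def using \<gamma> by (intro cos_gt_zero_pi) (auto intro: order_less_le_trans[of _ 0])
  define r0 where "r0 = norm z"
  have r0: "r0 \<ge> 0" by (simp add: r0_def)
  have main: "norm (H z) \<le> 4 * A * (1 + sqrt r0) ^ (2 * m) * exp (\<epsilon> * (1 + sqrt r0) powr \<gamma>)" if \<epsilon>: "\<epsilon> > 0" for \<epsilon>
  proof -
    \<comment> \<open>On the arc \<open>norm \<zeta> = sqrt T\<close> the damping has to win. The
      choice of \<open>T\<close> depends on \<open>\<epsilon>\<close>, but the bound obtained does
      not involve \<open>T\<close>, so \<open>\<epsilon>\<close> can tend to 0 at the end.\<close>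
    have "((\<lambda>T. T powr \<mu> / sqrt T powr \<gamma>) \<longlongrightarrow> 0) at_top" using \<gamma> \<mu> by real_asymp
    then have "((\<lambda>T. C * (T powr \<mu> / sqrt T powr \<gamma>)) \<longlongrightarrow> C * 0) at_top" by (intro tendsto_intros)
    then have "\<forall>\<^sub>F T in at_top. C * (T powr \<mu> / sqrt T powr \<gamma>) < \<epsilon> * c"
      by (rule order_tendstoD) (use \<epsilon> c in auto)
    with eventually_ge_at_top[of "max 1 r0"]
    have "\<forall>\<^sub>F T in at_top. T \<ge> max 1 r0 \<and> C * (T powr \<mu> / sqrt T powr \<gamma>) < \<epsilon> * c"
      by eventually_elim auto
    then obtain T where T: "T \<ge> 1" "T \<ge> r0" "C * (T powr \<mu> / sqrt T powr \<gamma>) < \<epsilon> * c"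
      unfolding eventually_at_top_linorder by fastforce
    have T2: "C * T powr \<mu> \<le> \<epsilon> * c * sqrt T powr \<gamma>" using T by (simp add: field_simps)
    obtain N b where b: "\<And>k. k < N \<Longrightarrow> b k \<noteq> (0::complex)"
       "\<And>r. r \<ge> 0 \<Longrightarrow> (\<Prod>k<N. 1 + r / norm (b k)) \<le> exp (C * r powr \<mu>)"
       "\<And>z. norm z \<le> T \<Longrightarrow> (\<Prod>k<N. norm (1 - z / b k)) \<le> 2 * norm (H z)"
       "\<And>z. norm z \<le> T \<Longrightarrow> norm (H z) \<le> 2 * (\<Prod>k<(N::nat). norm (1 - z / b k))"
      using model[of T] T by force
    \<comment> \<open>On the imaginary axis the factors are
      \<open>1 - t\<^sup>2 / norm (b k)\<close>, of modulus at most
      \<open>norm (1 - w / b k)\<close> for every \<open>w\<close> with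
      \<open>norm w = t\<^sup>2\<close>: one good point per circle suffices. At
      \<open>sqrt r0\<close> they are at least \<open>norm (1 - z / b k)\<close>.\<close>
    define E where "E = (\<lambda>\<zeta>. \<Prod>k<N. 1 + \<zeta>\<^sup>2 / of_real (norm (b k)) :: complex)"
    \<comment> \<open>The shift by 1 keeps the zero of the denominator and the branch cut away from
      the closed half plane, and on the imaginary axis \<open>norm (1 + \<zeta>) ^ (2 * m)\<close>
      is exactly \<open>(1 + t\<^sup>2) ^ m\<close>.\<close>
    define \<Phi> where "\<Phi> = (\<lambda>\<zeta>. E \<zeta> / (1 + \<zeta>) ^ (2 * m) * exp (- (of_real \<epsilon> * (1 + \<zeta>) powr of_real \<gamma>)))"
    have n\<Phi>: "norm (\<Phi> \<zeta>) = norm (E \<zeta>) / norm (1 + \<zeta>) ^ (2 * m) * exp (- (\<epsilon> * Re ((1 + \<zeta>) powr of_real \<gamma>)))" for \<zeta>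
      by (simp add: \<Phi>_def norm_mult norm_divide norm_power)
    have Rep: "Re ((1 + \<zeta>) powr of_real \<gamma>) \<ge> c * norm (1 + \<zeta>) powr \<gamma>" if "Re \<zeta> \<ge> 0" for \<zeta>
      unfolding c_def by (rule Re_powr_ge) (use that \<gamma> in auto)
    let ?S = "cball 0 (sqrt T) \<inter> {\<zeta>. Re \<zeta> \<ge> 0}"
    have clS: "closed ?S" by (intro closed_Int closed_cball closed_halfspace_Re_ge)
    have hol: "\<Phi> holomorphic_on {\<zeta>. Re \<zeta> > -1}"
      unfolding \<Phi>_def E_def
      by (intro holomorphic_on_mult holomorphic_on_divide holomorphic_on_prod holomorphic_on_exp'
           holomorphic_on_minus holomorphic_on_power holomorphic_on_add holomorphic_on_const
           holomorphic_on_ident holomorphic_on_powr)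
         (use b(1) in \<open>auto simp: complex_nonpos_Reals_iff add_eq_0_iff\<close>)
    have S: "?S \<subseteq> {\<zeta>. Re \<zeta> > -1}" by auto
    have holS: "\<Phi> holomorphic_on ?S" by (rule holomorphic_on_subset[OF hol S])
    have bound: "norm (\<Phi> (of_real (sqrt r0))) \<le> 2 * A"
    proof (rule maximum_modulus_frontier[of \<Phi> ?S])
      show "\<Phi> holomorphic_on interior ?S" by (rule holomorphic_on_subset[OF holS interior_subset])
      show "continuous_on (closure ?S) \<Phi>"
        unfolding closure_closed[OF clS] by (rule holomorphic_on_imp_continuous_on[OF holS])
      show "bounded ?S" by (meson Int_lower1 bounded_cball bounded_subset)
      show "of_real (sqrt r0) \<in> ?S" using T r0 by auto
      fix \<zeta> assume \<zeta>: "\<zeta> \<in> frontier ?S"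
      then have \<zeta>S: "norm \<zeta> \<le> sqrt T" "Re \<zeta> \<ge> 0"
        using closure_closed[OF clS] unfolding frontier_def by auto
      have "\<zeta> \<in> frontier (cball 0 (sqrt T)) \<union> frontier {\<zeta>. Re \<zeta> \<ge> 0}"
        using frontier_Int_subset \<zeta> by blast
      moreover have "frontier (cball 0 (sqrt T)) = sphere (0::complex) (sqrt T)" using T by simp
      moreover have "frontier {\<zeta>. Re \<zeta> \<ge> 0} = {\<zeta>. Re \<zeta> = 0}"
        using frontier_halfspace_ge[of "1::complex" 0] by (simp add: inner_complex_def)
      ultimately have cases: "norm \<zeta> = sqrt T \<or> Re \<zeta> = 0" by auto
      have ge1: "norm (1 + \<zeta>) \<ge> 1" "norm (1 + \<zeta>) \<ge> norm \<zeta>"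
      proof -
        show "norm (1 + \<zeta>) \<ge> 1" using complex_Re_le_cmod[of "1 + \<zeta>"] \<zeta>S by simp
        show "norm (1 + \<zeta>) \<ge> norm \<zeta>" using \<zeta>S by (simp add: cmod_def power2_eq_square algebra_simps)
      qed
      show "norm (\<Phi> \<zeta>) \<le> 2 * A"
      proof (cases "Re \<zeta> = 0")
        case True
        define t where "t = Im \<zeta>"
        have zt: "\<zeta> = \<i> * of_real t" using True by (simp add: t_def complex_eq_iff)
        have t2: "norm \<zeta> = \<bar>t\<bar>" by (simp add: zt norm_mult)
        have tT: "t\<^sup>2 \<le> T"
        proof -
          have "\<bar>t\<bar> ^ 2 \<le> sqrt T ^ 2" using \<zeta>S t2 by (intro power_mono) auto
          then show ?thesis using T by simp
        qed
        obtain w where w: "norm w = t\<^sup>2" "norm (H w) \<le> A * (1 + t\<^sup>2) ^ m" using min[of "t\<^sup>2"] by auto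
        have "norm (E \<zeta>) \<le> (\<Prod>k<N. norm (1 - w / b k))"
          unfolding E_def prod_norm[symmetric]
        proof (rule prod_mono, intro conjI)
          fix k assume "k \<in> {..<N}"
          have "1 + \<zeta>\<^sup>2 / of_real (norm (b k)) = of_real (norm (1::complex) - norm (w / b k))"
            by (simp add: zt power_mult_distrib norm_divide w)
          then have "norm (1 + \<zeta>\<^sup>2 / of_real (norm (b k))) = \<bar>norm (1::complex) - norm (w / b k)\<bar>"
            by (simp only: norm_of_real)
          then show "norm (1 + \<zeta>\<^sup>2 / of_real (norm (b k))) \<le> norm (1 - w / b k)"
            using norm_triangle_ineq3[of 1 "w / b k"] by simp
        qed simp
        also have "\<dots> \<le> 2 * norm (H w)" using b(3) w tT by simp
        also have "\<dots> \<le> 2 * A * (1 + t\<^sup>2) ^ m" using w by simp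
        also have "(1 + t\<^sup>2) ^ m = norm (1 + \<zeta>) ^ (2 * m)"
          by (simp add: power_mult zt cmod_power2)
        finally have le: "norm (E \<zeta>) \<le> 2 * A * norm (1 + \<zeta>) ^ (2 * m)" .
        have "0 < norm (1 + \<zeta>) ^ (2 * m)" by (rule zero_less_power) (use ge1 in linarith)
        with le have "norm (E \<zeta>) / norm (1 + \<zeta>) ^ (2 * m) \<le> 2 * A"
          by (simp only: pos_divide_le_eq)
        moreover have "exp (- (\<epsilon> * Re ((1 + \<zeta>) powr of_real \<gamma>))) \<le> 1"
        proof -
          have "0 \<le> c * norm (1 + \<zeta>) powr \<gamma>" using c by simp
          then have "0 \<le> Re ((1 + \<zeta>) powr of_real \<gamma>)" using Rep[OF \<zeta>S(2)] by linarith
          then show ?thesis using \<epsilon> by simp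
        qed
        ultimately have "norm (\<Phi> \<zeta>) \<le> 2 * A * 1" unfolding n\<Phi> by (intro mult_mono) (use A in auto)
        then show ?thesis by simp
      next
        case False
        then have nT: "norm \<zeta> = sqrt T" using cases by simp
        have "norm (E \<zeta>) \<le> (\<Prod>k<N. 1 + T / norm (b k))"
          unfolding E_def prod_norm[symmetric]
        proof (rule prod_mono, intro conjI)
          fix k assume "k \<in> {..<N}"
          have "norm (1 + \<zeta>\<^sup>2 / of_real (norm (b k))) \<le> norm (1::complex) + norm (\<zeta>\<^sup>2 / of_real (norm (b k)))"
            by (rule norm_triangle_ineq)
          also have "\<dots> = 1 + T / norm (b k)" using T by (simp add: norm_divide norm_power nT)
          finally show "norm (1 + \<zeta>\<^sup>2 / of_real (norm (b k))) \<le> 1 + T / norm (b k)" .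
        qed simp
        also have "\<dots> \<le> exp (C * T powr \<mu>)" using b(2) T by simp
        finally have E: "norm (E \<zeta>) \<le> exp (C * T powr \<mu>)" .
        have "norm (E \<zeta>) / norm (1 + \<zeta>) ^ (2 * m) \<le> norm (E \<zeta>) / 1"
          by (rule frac_le) (use one_le_power[OF ge1(1), of "2 * m"] in auto)
        then have "norm (E \<zeta>) / norm (1 + \<zeta>) ^ (2 * m) \<le> exp (C * T powr \<mu>)" using E by simp
        then have "norm (\<Phi> \<zeta>) \<le> exp (C * T powr \<mu>) * exp (- (\<epsilon> * Re ((1 + \<zeta>) powr of_real \<gamma>)))"
          unfolding n\<Phi> by (intro mult_right_mono) auto
        also have "\<dots> = exp (C * T powr \<mu> - \<epsilon> * Re ((1 + \<zeta>) powr of_real \<gamma>))" by (simp add: exp_diff exp_minus field_simps)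
        also have "\<dots> \<le> 1"
        proof -
          have "c * sqrt T powr \<gamma> \<le> c * norm (1 + \<zeta>) powr \<gamma>"
            using ge1 nT c \<gamma> T by (intro mult_left_mono powr_mono2) auto
          also have "\<dots> \<le> Re ((1 + \<zeta>) powr of_real \<gamma>)" by (rule Rep[OF \<zeta>S(2)])
          finally have "\<epsilon> * (c * sqrt T powr \<gamma>) \<le> \<epsilon> * Re ((1 + \<zeta>) powr of_real \<gamma>)" using \<epsilon> by simp
          then show ?thesis using T2 by (simp add: mult.assoc)
        qed
        finally show ?thesis using A by simp
      qed
    qed
    have "norm (H z) \<le> 2 * (\<Prod>k<N. norm (1 - z / b k))" using b(4) T by (simp add: r0_def)
    also have "(\<Prod>k<N. norm (1 - z / b k)) \<le> (\<Prod>k<N. norm (1 + (of_real (sqrt r0))\<^sup>2 / of_real (norm (b k)) :: complex))"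
    proof (rule prod_mono, intro conjI)
      fix k assume "k \<in> {..<N}"
      have "norm (1 - z / b k) \<le> norm (1::complex) + norm (z / b k)" by (rule norm_triangle_ineq4)
      also have "\<dots> = \<bar>1 + r0 / norm (b k)\<bar>" using r0 by (simp add: norm_divide r0_def)
      also have "\<dots> = norm (of_real (1 + r0 / norm (b k)) :: complex)" by (simp only: norm_of_real)
      also have "of_real (1 + r0 / norm (b k)) = 1 + (of_real (sqrt r0))\<^sup>2 / (of_real (norm (b k)) :: complex)"
        using r0 by (simp flip: of_real_power)
      finally show "norm (1 - z / b k) \<le> norm (1 + (of_real (sqrt r0))\<^sup>2 / of_real (norm (b k)) :: complex)" .
    qed simp
    also have "\<dots> = norm (E (of_real (sqrt r0)))" by (simp add: E_def prod_norm)
    also have "norm (E (of_real (sqrt r0))) \<le> 2 * A * (1 + sqrt r0) ^ (2 * m) * exp (\<epsilon> * (1 + sqrt r0) powr \<gamma>)"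
    proof -
      have n1: "norm (1 + complex_of_real (sqrt r0)) = 1 + sqrt r0"
        using r0 by (metis abs_of_nonneg add_nonneg_nonneg norm_of_real of_real_1 of_real_add real_sqrt_ge_zero zero_le_one)
      have "norm (E (of_real (sqrt r0))) = norm (\<Phi> (of_real (sqrt r0))) * (1 + sqrt r0) ^ (2 * m)
          * exp (\<epsilon> * Re ((1 + complex_of_real (sqrt r0)) powr of_real \<gamma>))"
      proof -
        have "1 + sqrt r0 \<noteq> 0" using real_sqrt_ge_zero[OF r0] by linarith
        then show ?thesis unfolding n\<Phi> n1 by (simp add: exp_minus field_simps)
      qed
      also have "\<dots> \<le> (2 * A) * (1 + sqrt r0) ^ (2 * m) * exp (\<epsilon> * (1 + sqrt r0) powr \<gamma>)"
      proof (intro mult_mono)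
        have "Re ((1 + complex_of_real (sqrt r0)) powr of_real \<gamma>) \<le> norm ((1 + complex_of_real (sqrt r0)) powr of_real \<gamma>)"
          by (rule complex_Re_le_cmod)
        also have "\<dots> = (1 + sqrt r0) powr \<gamma>"
        proof -
          have "(1 + complex_of_real (sqrt r0)) powr of_real \<gamma> = of_real ((1 + sqrt r0) powr \<gamma>)"
            using r0 by (simp flip: powr_of_real)
          then show ?thesis by simp
        qed
        finally show "exp (\<epsilon> * Re ((1 + complex_of_real (sqrt r0)) powr of_real \<gamma>)) \<le> exp (\<epsilon> * (1 + sqrt r0) powr \<gamma>)"
          using \<epsilon> by simp
      qed (use bound r0 A in auto)
      finally show ?thesis .
    qed
    finally show ?thesis by (simp add: mult_ac)
  qed
  have "((\<lambda>\<epsilon>. 4 * A * (1 + sqrt r0) ^ (2 * m) * exp (\<epsilon> * (1 + sqrt r0) powr \<gamma>)) \<longlongrightarrow>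
         4 * A * (1 + sqrt r0) ^ (2 * m) * exp (0 * (1 + sqrt r0) powr \<gamma>)) (at_right 0)"
    by (intro tendsto_intros)
  then have "norm (H z) \<le> 4 * A * (1 + sqrt r0) ^ (2 * m) * exp (0 * (1 + sqrt r0) powr \<gamma>)"
    by (rule tendsto_lowerbound) (use main in \<open>auto intro!: eventually_at_rightI[of 0 1]\<close>)
  then show ?thesis by (simp add: r0_def)
qed

section \<open>Quotients of entire functions\<close>

lemma growth_translate:
  assumes g: "growth l f" and l: "l \<ge> 0"
  shows "growth l (\<lambda>z. f (z + a))"
proof -
  obtain C where C: "C \<ge> 0" "\<And>z. norm (f z) \<le> exp (C * (1 + norm z) powr l)"
    using growthE[OF g] by blast
  have "norm (f (z + a)) \<le> exp ((C * (1 + norm a) powr l) * (1 + norm z) powr l)" for z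
  proof -
    have "1 + norm (z + a) \<le> 1 + norm z + norm a" using norm_triangle_ineq[of z a] by simp
    also have "\<dots> \<le> (1 + norm a) * (1 + norm z)" by (simp add: algebra_simps)
    finally have "(1 + norm (z + a)) powr l \<le> ((1 + norm a) * (1 + norm z)) powr l"
      using l by (intro powr_mono2) auto
    also have "\<dots> = (1 + norm a) powr l * (1 + norm z) powr l" by (rule powr_mult)
    finally have "C * (1 + norm (z + a)) powr l \<le> C * ((1 + norm a) powr l * (1 + norm z) powr l)"
      using C(1) by (rule mult_left_mono)
    then show ?thesis using C(2)[of "z + a"] 
      by (elim order_trans) (simp add: mult.assoc)
  qed
  moreover have "(f \<circ> (\<lambda>z. z + a)) holomorphic_on UNIV"
    by (rule holomorphic_on_compose[OF _ entire_subset[OF growthD[OF g]]]) (intro holomorphic_intros)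
  ultimately show ?thesis
    unfolding growth_def using C(1) by (auto intro!: exI[of _ "C * (1 + norm a) powr l"] simp: o_def)
qed

lemma growth_mult:
  assumes "growth l f" "growth l g"
  shows "growth l (\<lambda>z. f z * g z)"
proof -
  obtain C where C: "C \<ge> 0" "\<And>z. norm (f z) \<le> exp (C * (1 + norm z) powr l)"
    using growthE[OF assms(1)] by blast
  obtain D where D: "D \<ge> 0" "\<And>z. norm (g z) \<le> exp (D * (1 + norm z) powr l)"
    using growthE[OF assms(2)] by blast
  have "norm (f z * g z) \<le> exp ((C + D) * (1 + norm z) powr l)" for z
    unfolding norm_mult distrib_right exp_add using C(2) D(2) by (intro mult_mono) auto
  then show ?thesis unfolding growth_def
    using C(1) D(1) growthD[OF assms(1)] growthD[OF assms(2)]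
    by (auto intro!: holomorphic_on_mult exI[of _ "C + D"])
qed

lemma growth_add:
  assumes "growth l f" "growth l g" and l: "l \<ge> 0"
  shows "growth l (\<lambda>z. f z + g z)"
proof -
  obtain C where C: "C \<ge> 0" "\<And>z. norm (f z) \<le> exp (C * (1 + norm z) powr l)"
    using growthE[OF assms(1)] by blast
  obtain D where D: "D \<ge> 0" "\<And>z. norm (g z) \<le> exp (D * (1 + norm z) powr l)"
    using growthE[OF assms(2)] by blast
  have "norm (f z + g z) \<le> exp ((C + D + 1) * (1 + norm z) powr l)" for z
  proof -
    let ?y = "(1 + norm z) powr l"
    have y: "?y \<ge> 1" using l by (simp add: ge_one_powr_ge_zero)
    have "norm (f z) \<le> exp ((C + D) * ?y)"
      using C D y by (intro order_trans[OF C(2)]) (simp add: mult_right_mono)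
    moreover have "norm (g z) \<le> exp ((C + D) * ?y)"
      using C D y by (intro order_trans[OF D(2)]) (simp add: mult_right_mono)
    ultimately have "norm (f z + g z) \<le> 2 * exp ((C + D) * ?y)"
      using norm_triangle_ineq[of "f z" "g z"] by linarith
    also have "\<dots> \<le> exp ?y * exp ((C + D) * ?y)"
          proof (rule mult_right_mono)
      show "2 \<le> exp ?y" using exp_ge_add_one_self[of ?y] y by linarith
    qed simp
    also have "\<dots> = exp ((C + D + 1) * ?y)" by (simp add: algebra_simps flip: exp_add)
    finally show ?thesis .
  qed
  then show ?thesis unfolding growth_def
    using C(1) D(1) growthD[OF assms(1)] growthD[OF assms(2)]
    by (auto intro!: holomorphic_on_add exI[of _ "C + D + 1"])
qed

lemma growth_const:
  assumes "l \<ge> 0" shows "growth l (\<lambda>_. c)"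
proof -
  have "norm c \<le> exp (norm c * (1 + norm z) powr l)" for z :: complex
  proof -
    have "1 \<le> (1 + norm z) powr l" using assms by (simp add: ge_one_powr_ge_zero)
    then have "norm c * 1 \<le> norm c * (1 + norm z) powr l" by (intro mult_left_mono) auto
    then show ?thesis using exp_ge_add_one_self[of "norm c * (1 + norm z) powr l"] by linarith
  qed
  then show ?thesis unfolding growth_def by (auto intro!: exI[of _ "norm c"])
qed

lemma growth_ident:
  assumes "l > 0" shows "growth l (\<lambda>z. z)"
proof -
  have "norm z \<le> exp (1 / l * (1 + norm z) powr l)" for z :: complex
  proof -
    have "l * ln (1 + norm z) \<le> (1 + norm z) powr l"
      using ln_le_minus_one[of "(1 + norm z) powr l"] add_pos_nonneg[OF zero_less_one norm_ge_zero[of z]]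
      by (simp add: ln_powr)
    then have "ln (1 + norm z) \<le> 1 / l * (1 + norm z) powr l" using assms by (simp add: field_simps)
    then have "exp (ln (1 + norm z)) \<le> exp (1 / l * (1 + norm z) powr l)" by simp
    then show ?thesis by (simp add: add_pos_nonneg)
  qed
  then show ?thesis unfolding growth_def using assms by (auto intro!: exI[of _ "1 / l"])
qed

lemma growth_poly: "l > 0 \<Longrightarrow> growth l (poly p)"
proof (induction p)
  case (pCons a p)
  then show ?case
    using growth_add[OF growth_const[of l a] growth_mult[OF growth_ident pCons.IH]] by simp
next
  case 0
  have "poly 0 = (\<lambda>_. 0 :: complex)" by auto
  then show ?case using growth_const[of l 0] 0 by simp
qed

lemma entire_poly: "poly p holomorphic_on A" for p :: "complex poly"
  by (rule entire_subset[OF growthD[OF growth_poly[OF zero_less_one]]])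

lemma growth_fwd_diff:
  assumes "growth l f" "l \<ge> 0" shows "growth l (fwd_diff n f)"
proof (induction n)
  case (Suc n)
  show ?case
    using growth_add[OF growth_translate[OF Suc assms(2), of 1]
        growth_mult[OF growth_const[OF assms(2), of "-1"] Suc] assms(2)] by simp
qed (use assms in simp)

section \<open>Upper and lower bounds for polynomials\<close>

lemma poly_norm_le:
  obtains K d where "K \<ge> 0" "\<And>z::complex. norm (poly p z) \<le> K * (1 + norm z) ^ d"
proof -
  have "\<exists>K\<ge>0. \<exists>d. \<forall>z::complex. norm (poly p z) \<le> K * (1 + norm z) ^ d"
  proof (induction p)
    case 0
    then show ?case by (auto intro!: exI[of _ 0])
  next
    case (pCons a p)
    then obtain K d where K: "K \<ge> 0" "\<And>z::complex. norm (poly p z) \<le> K * (1 + norm z) ^ d" by blast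
    have "norm (poly (pCons a p) z) \<le> (norm a + K) * (1 + norm z) ^ Suc d" for z :: complex
    proof -
      have "norm (poly (pCons a p) z) \<le> norm a + norm z * norm (poly p z)"
        using norm_triangle_ineq[of a "z * poly p z"] by (simp add: norm_mult)
      also have "\<dots> \<le> norm a * (1 + norm z) ^ Suc d + (1 + norm z) * (K * (1 + norm z) ^ d)"
      proof (intro add_mono mult_mono)
        have "1 \<le> (1 + norm z) ^ Suc d" by (rule one_le_power) simp
        from mult_left_mono[OF this, of "norm a"] show "norm a \<le> norm a * (1 + norm z) ^ Suc d" by simp
      qed (use K in auto)
      finally show ?thesis by (simp add: algebra_simps)
    qed
    then show ?case using K(1) by (intro exI[of _ "norm a + K"] conjI exI[of _ "Suc d"]) auto
  qed
  then show ?thesis using that by blast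
qed

lemma poly_norm_asymp:
  fixes p :: "complex poly"
  assumes "p \<noteq> 0"
  obtains c C R where "c > 0" "C > 0" "\<And>z. norm z \<ge> R \<Longrightarrow> c * norm z ^ degree p \<le> norm (poly p z)"
    "\<And>z. norm z \<ge> R \<Longrightarrow> norm (poly p z) \<le> C * norm z ^ degree p"
proof -
  define L where "L = norm (lead_coeff p)"
  have L: "L > 0" using assms by (simp add: L_def)
  have "((\<lambda>x. norm (poly p x / x ^ degree p)) \<longlongrightarrow> L) at_infinity"
    unfolding L_def by (intro tendsto_norm poly_divide_tendsto_aux)
  then have "\<forall>\<^sub>F x in at_infinity. L / 2 < norm (poly p x / x ^ degree p)"
    "\<forall>\<^sub>F x in at_infinity. norm (poly p x / x ^ degree p) < 2 * L"
    by (rule order_tendstoD; use L in simp)+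
  then have "\<forall>\<^sub>F x in at_infinity. L / 2 < norm (poly p x / x ^ degree p) \<and> norm (poly p x / x ^ degree p) < 2 * L"
    by (rule eventually_conj)
  then obtain R where R: "\<And>x. norm x \<ge> R \<Longrightarrow> L / 2 < norm (poly p x / x ^ degree p) \<and> norm (poly p x / x ^ degree p) < 2 * L"
    unfolding eventually_at_infinity by blast
  show ?thesis
  proof (rule that[of "L / 2" "2 * L" "max R 1"])
    fix z :: complex assume z: "norm z \<ge> max R 1"
    then have "norm z ^ degree p > 0" by (intro zero_less_power) linarith
    then show "L / 2 * norm z ^ degree p \<le> norm (poly p z)" "norm (poly p z) \<le> 2 * L * norm z ^ degree p"
      using R[of z] z by (auto simp: norm_divide norm_power field_simps)
  qed (use L in auto)
qed

section \<open>Local factorization and division of entire functions\<close>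

lemma entire_local_factor:
  assumes g: "g holomorphic_on UNIV" and nz: "g z1 \<noteq> 0"
  obtains n u r where "r > 0" "u holomorphic_on ball c r"
    "\<forall>w\<in>ball c r. g w = (w - c) ^ n * u w \<and> u w \<noteq> 0"
proof (cases "g c = 0")
  case True
  have "\<not> g constant_on UNIV"
  proof
    assume "g constant_on UNIV"
    then have "g c = g z1" unfolding constant_on_def by auto
    then show False using True nz by simp
  qed
  then show ?thesis
    by (rule holomorphic_factor_zero_nonconstant[OF g open_UNIV connected_UNIV UNIV_I True]) (rule that, auto)
next
  case False
  have "continuous (at c) g" using entire_continuous[OF g, of UNIV] continuous_on_eq_continuous_at by blast
  then obtain e where "e > 0" "\<forall>y. dist c y < e \<longrightarrow> g y \<noteq> 0"
    using continuous_at_avoid[of c g 0] False by auto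
  then show ?thesis by (intro that[of e g 0]) (auto intro: entire_subset[OF g])
qed

lemma entire_eventually_nonzero:
  assumes "g holomorphic_on UNIV" "g z1 \<noteq> 0"
  shows "\<forall>\<^sub>F w in at c. g w \<noteq> 0"
proof -
  obtain n u r where "r > 0" "u holomorphic_on ball c r"
    "\<forall>w\<in>ball c r. g w = (w - c) ^ n * u w \<and> u w \<noteq> 0"
    by (rule entire_local_factor[OF assms, of c])
  then show ?thesis unfolding eventually_at by (intro exI[of _ r]) (auto simp: dist_commute)
qed

text \<open>A rational representation is only given off a discrete set; continuity fills in the
  exceptional points.\<close>

lemma entire_eq_if_eventually_eq:
  assumes "f holomorphic_on UNIV" "g holomorphic_on UNIV" "\<forall>\<^sub>F w in at z. f w = g w"
  shows "f z = g z"
proof -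
  have "isCont f z" "isCont g z"
    using entire_continuous[OF assms(1), of UNIV] entire_continuous[OF assms(2), of UNIV]
    by (simp_all add: continuous_on_eq_continuous_at)
  then have "f \<midarrow>z\<rightarrow> f z" "g \<midarrow>z\<rightarrow> g z" by (simp_all add: isCont_def)
  then have "g \<midarrow>z\<rightarrow> f z" using Lim_transform_eventually[OF _ assms(3)] by simp
  then show ?thesis using \<open>g \<midarrow>z\<rightarrow> g z\<close> by (rule LIM_unique)
qed

text \<open>The function \<open>Q f / g\<close> has only removable singularities. At a zero of
  \<open>g / f\<close> the polynomial \<open>Q\<close> supplies the full vanishing order of
  \<open>g\<close>; at any other point \<open>f\<close> vanishes at least as often as
  \<open>g\<close>, since otherwise \<open>g / f\<close> would tend to 0 there.\<close>

lemma finite_mero_zeros_quotient: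
  assumes f: "f holomorphic_on UNIV" "f z1 \<noteq> 0" and g: "g holomorphic_on UNIV" "g z2 \<noteq> 0"
    and fin: "finite (mero_zeros (\<lambda>z. g z / f z))"
  obtains Q H where "Q \<noteq> 0" "H holomorphic_on UNIV" "\<forall>z. poly Q z * f z = H z * g z"
proof -
  let ?Z = "mero_zeros (\<lambda>z. g z / f z)"
  have "\<exists>n u r. r > 0 \<and> u holomorphic_on ball c r \<and>
    (\<forall>w\<in>ball c r. g w = (w - c) ^ n * u w \<and> u w \<noteq> 0)" for c
    by (rule entire_local_factor[OF g, of c]) (intro exI conjI)
  then obtain n u r where gf: "\<And>c. r c > 0" "\<And>c. u c holomorphic_on ball c (r c)"
    "\<And>c w. w \<in> ball c (r c) \<Longrightarrow> g w = (w - c) ^ n c * u c w \<and> u c w \<noteq> 0"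
    by metis
  define Q where "Q = (\<Prod>a\<in>?Z. [:- a, 1:] ^ n a)"
  have Q0: "Q \<noteq> 0" unfolding Q_def using fin by (simp add: prod_zero_iff)
  \<comment> \<open>The last clause isolates the zeros of \<open>g\<close>, so that \<open>g\<close>
    can be cancelled when two local solutions are compared.\<close>
  have "\<exists>s k. s > 0 \<and> k holomorphic_on ball c s \<and> (\<forall>w\<in>ball c s. poly Q w * f w = k w * g w) \<and>
      (\<forall>w\<in>ball c s. w \<noteq> c \<longrightarrow> g w \<noteq> 0)" for c
  proof (cases "c \<in> ?Z")
    case True
    define k where "k = (\<lambda>w. poly (\<Prod>a\<in>?Z - {c}. [:- a, 1:] ^ n a) w * f w / u c w)"
    have "k holomorphic_on ball c (r c)"
      unfolding k_def
      by (rule holomorphic_on_divide[OF holomorphic_on_mult[OF entire_poly entire_subset[OF f(1)]] gf(2)])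
        (use gf(3)[of _ c] in auto)
    moreover have "poly Q w * f w = k w * g w" if "w \<in> ball c (r c)" for w
    proof -
      have "Q = [:- c, 1:] ^ n c * (\<Prod>a\<in>?Z - {c}. [:- a, 1:] ^ n a)"
        unfolding Q_def by (rule prod.remove[OF fin True])
      then have "poly Q w = (w - c) ^ n c * poly (\<Prod>a\<in>?Z - {c}. [:- a, 1:] ^ n a) w" by simp
      then show ?thesis using gf(3)[OF that] by (simp add: k_def)
    qed
    ultimately show ?thesis using gf(1) gf(3)[of _ c] by (intro exI[of _ "r c"] exI[of _ k]) auto
  next
    case False
    obtain j v s where fv: "s > 0" "v holomorphic_on ball c s"
      "\<forall>w\<in>ball c s. f w = (w - c) ^ j * v w \<and> v w \<noteq> 0"
      by (rule entire_local_factor[OF f, of c])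
    define t where "t = min s (r c)"
    have t: "t > 0" "ball c t \<subseteq> ball c s" "ball c t \<subseteq> ball c (r c)" using fv(1) gf(1) by (auto simp: t_def)
    have uh: "u c holomorphic_on ball c t" and vh: "v holomorphic_on ball c t"
      using holomorphic_on_subset[OF gf(2) t(3)] holomorphic_on_subset[OF fv(2) t(2)] .
    have pw: "(\<lambda>w. (w - c) ^ i) holomorphic_on A" for i A by (intro holomorphic_intros)
    have jn: "n c \<le> j"
    proof (rule ccontr)
      assume "\<not> n c \<le> j"
      then have lt: "j < n c" by simp
      have hol: "(\<lambda>w. (w - c) ^ (n c - j) * u c w / v w) holomorphic_on ball c t"
        by (rule holomorphic_on_divide[OF holomorphic_on_mult[OF pw uh] vh]) (use fv(3) t in auto)
      have "isCont (\<lambda>w. (w - c) ^ (n c - j) * u c w / v w) c"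
        by (rule bspec[OF holomorphic_on_imp_continuous_on[OF hol,
              unfolded continuous_on_eq_continuous_at[OF open_ball]]]) (use t(1) in simp)
      then have "(\<lambda>w. (w - c) ^ (n c - j) * u c w / v w) \<midarrow>c\<rightarrow> 0"
        using lt by (simp add: isCont_def power_0_left)
      moreover have "\<forall>\<^sub>F w in at c. (w - c) ^ (n c - j) * u c w / v w = g w / f w"
        unfolding eventually_at
      proof (intro exI[of _ t] conjI t(1) ballI impI)
        fix w assume w: "w \<noteq> c \<and> dist w c < t"
        then have "w \<in> ball c t" by (simp add: dist_commute)
        then have wr: "w \<in> ball c (r c)" and ws: "w \<in> ball c s" using t by auto
        have "g w = (w - c) ^ n c * u c w" "f w = (w - c) ^ j * v w" "v w \<noteq> 0"
          using gf(3)[OF wr] bspec[OF fv(3) ws] by blast+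
        moreover have "(w - c) ^ n c = (w - c) ^ (n c - j) * (w - c) ^ j"
          using lt by (simp flip: power_add)
        ultimately show "(w - c) ^ (n c - j) * u c w / v w = g w / f w" using w by simp
      qed
      ultimately have "((\<lambda>w. g w / f w) \<longlongrightarrow> 0) (at c)" by (rule Lim_transform_eventually)
      then show False using False by (simp add: mero_zeros_def)
    qed
    define k where "k = (\<lambda>w. poly Q w * ((w - c) ^ (j - n c) * v w) / u c w)"
    have "k holomorphic_on ball c t"
      unfolding k_def
      by (rule holomorphic_on_divide[OF holomorphic_on_mult[OF entire_poly holomorphic_on_mult[OF pw vh]] uh])
        (use gf(3)[of _ c] t in auto)
    moreover have "poly Q w * f w = k w * g w" if "w \<in> ball c t" for w
    proof -
      have wr: "w \<in> ball c (r c)" and ws: "w \<in> ball c s" using t that by auto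
      have "g w = (w - c) ^ n c * u c w" "u c w \<noteq> 0" "f w = (w - c) ^ j * v w"
        using gf(3)[OF wr] bspec[OF fv(3) ws] by blast+
      moreover have "(w - c) ^ j = (w - c) ^ (j - n c) * (w - c) ^ n c"
        using jn by (simp flip: power_add)
      ultimately show ?thesis by (simp add: k_def)
    qed
    ultimately show ?thesis using gf(3)[of _ c] t by (intro exI[of _ t] exI[of _ k]) auto
  qed
  then obtain s k where sk: "\<And>c. s c > 0" "\<And>c. k c holomorphic_on ball c (s c)"
    "\<And>c w. w \<in> ball c (s c) \<Longrightarrow> poly Q w * f w = k c w * g w"
    "\<And>c w. w \<in> ball c (s c) \<Longrightarrow> w \<noteq> c \<Longrightarrow> g w \<noteq> 0"
    by metis
  \<comment> \<open>Each point takes its value from its own local solution; cancelling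
    \<open>g\<close> shows agreement with the solution on any of the chosen discs containing the
    point.\<close>
  define H where "H = (\<lambda>c. k c c)"
  have eq: "H w = k c w" if w: "w \<in> ball c (s c)" for c w
  proof (cases "w = c")
    case False
    have "H w * g w = k c w * g w"
      using sk(3)[of w w] sk(3)[OF w] sk(1)[of w] unfolding H_def by (metis centre_in_ball)
    then show ?thesis using sk(4)[OF w False] by simp
  qed (simp add: H_def)
  have Hb: "H holomorphic_on ball c (s c)" for c
    by (rule holomorphic_transform[OF sk(2)]) (simp add: eq)
  have "H field_differentiable at c" for c
    by (rule holomorphic_on_imp_differentiable_at[OF Hb[of c] open_ball]) (use sk(1) in simp)
  then have "H holomorphic_on UNIV" by (simp add: holomorphic_on_def field_differentiable_at_within)
  moreover have "poly Q z * f z = H z * g z" for z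
    using sk(3)[of z z] sk(1)[of z] by (simp add: H_def)
  ultimately show ?thesis using that Q0 by blast
qed

section \<open>Zeros of the difference quotient\<close>

text \<open>If every circle had a point where \<open>H\<close> is at most
  \<open>A * (1 + r) ^ m\<close>, then \<open>min_modulus_bound\<close> would make \<open>H\<close>
  of polynomial growth, hence a polynomial by Liouville. A single radius is enough because
  \<open>A\<close> is free.\<close>

lemma minimum_modulus_unbounded:
  assumes F: "growth l F" and g: "growth l g" and H: "H holomorphic_on UNIV"
    and eq: "\<And>z. F z = H z * g z" and nz: "F 0 \<noteq> 0" and l: "0 < l" "l < 1 / 2"
    and np: "\<nexists>p. \<forall>z. H z = poly p z"
  obtains r where "r \<ge> 0" "\<forall>z. norm z = r \<longrightarrow> norm (H z) > A * (1 + r) ^ m"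
proof -
  have nz': "H 0 \<noteq> 0" "g 0 \<noteq> 0" using nz eq[of 0] by auto
  have l0: "l \<ge> 0" using l by simp
  define F1 where "F1 = (\<lambda>z. inverse (F 0) * F z)"
  define g1 where "g1 = (\<lambda>z. inverse (g 0) * g z)"
  define H1 where "H1 = (\<lambda>z. inverse (H 0) * H z)"
  define \<mu> where "\<mu> = (l + 1 / 2) / 2"
  have \<mu>: "l < \<mu>" "\<mu> < 1 / 2" "\<mu> < 1" "0 < \<mu>" using l by (auto simp: \<mu>_def)
  have gF1: "growth l F1" unfolding F1_def by (rule growth_mult[OF growth_const[OF l0] F])
  have gg1: "growth l g1" unfolding g1_def by (rule growth_mult[OF growth_const[OF l0] g])
  have hH1: "H1 holomorphic_on UNIV" unfolding H1_def by (rule holomorphic_on_mult[OF holomorphic_on_const H])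
  have eq1: "F1 z = H1 z * g1 z" for z
    using nz nz' by (simp add: F1_def H1_def g1_def eq field_simps)
  have one: "F1 0 = 1" "g1 0 = 1" "H1 0 = 1" using nz nz' by (auto simp: F1_def g1_def H1_def)
  obtain C where C: "C \<ge> 0" "\<forall>T>0. \<exists>(N::nat) b. (\<forall>k<N. b k \<noteq> (0::complex)) \<and>
     (\<forall>r\<ge>0. (\<Prod>k<N. 1 + r / norm (b k)) \<le> exp (C * r powr \<mu>)) \<and>
     (\<forall>z. norm z \<le> T \<longrightarrow> (\<Prod>k<N. norm (1 - z / b k)) \<le> 2 * norm (H1 z) \<and>
        norm (H1 z) \<le> 2 * (\<Prod>k<N. norm (1 - z / b k)))"
    by (rule quotient_model[OF gF1 gg1 hH1 eq1 one l(1) \<mu>(1,3)])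
  \<comment> \<open>Rescales \<open>A\<close> for \<open>H1 = H / H 0\<close> and provides the
    constant at least 1 that \<open>min_modulus_bound\<close> asks for.\<close>
  define B where "B = max 1 (A / norm (H 0))"
  have "\<exists>r\<ge>0. \<forall>z. norm z = r \<longrightarrow> norm (H1 z) > B * (1 + r) ^ m"
  proof (rule ccontr)
    assume neg: "\<not> (\<exists>r\<ge>0. \<forall>z. norm z = r \<longrightarrow> norm (H1 z) > B * (1 + r) ^ m)"
    have "norm (H1 z) \<le> 4 * B * (1 + sqrt (norm z)) ^ (2 * m)" for z
    proof (rule min_modulus_bound[OF C(1) \<mu>(4,2) C(2)[rule_format]])
      show "B \<ge> 1" by (simp add: B_def)
      fix r :: real assume "r \<ge> 0"
      then show "\<exists>z. norm z = r \<and> norm (H1 z) \<le> B * (1 + r) ^ m"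
        using neg by (metis not_le)
    qed
    have bd: "norm (H1 z) \<le> (4 * B * 4 ^ m) * norm z ^ m" if z: "1 \<le> norm z" for z
    proof -
      have "norm (H1 z) \<le> 4 * B * (1 + sqrt (norm z)) ^ (2 * m)" by fact
      also have "\<dots> \<le> 4 * B * (2 * sqrt (norm z)) ^ (2 * m)"
        using z by (intro mult_left_mono power_mono) (auto simp: B_def)
      also have "(2 * sqrt (norm z)) ^ (2 * m) = 4 ^ m * norm z ^ m"
        by (simp add: power_mult power_mult_distrib)
      finally show ?thesis by simp
    qed
    define p where "p = (\<Sum>k\<le>m. monom ((deriv ^^ k) H1 0 / fact k) k)"
    have p: "H1 z = poly p z" for z
      using Liouville_polynomial[OF hH1 bd, where \<xi> = z] by (simp add: p_def poly_sum poly_monom)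
    have "H z = poly (smult (H 0) p) z" for z
      using nz' by (simp add: p[symmetric]) (simp add: H1_def)
    then show False using np by blast
  qed
  then obtain r where r: "r \<ge> 0" "\<forall>z. norm z = r \<longrightarrow> norm (H1 z) > B * (1 + r) ^ m" by blast
  have "norm (H z) > A * (1 + r) ^ m" if z: "norm z = r" for z
  proof -
    have "A * (1 + r) ^ m \<le> norm (H 0) * B * (1 + r) ^ m"
      using nz' r(1) by (intro mult_right_mono) (auto simp: B_def field_simps max_def)
    also have "\<dots> < norm (H 0) * norm (H1 z)" using r(2)[rule_format, OF z] nz' by simp
    also have "\<dots> = norm (H z)" using nz' by (simp add: H1_def norm_mult norm_inverse)
    finally show ?thesis .
  qed
  then show ?thesis using that[OF r(1)] by blast
qed

lemma transcendental_translate: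
  assumes "transcendental_entire f"
  shows "transcendental_entire (\<lambda>z. f (z + a))"
proof -
  have hol: "f holomorphic_on UNIV" using assms by (simp add: transcendental_entire_def)
  have "(f \<circ> (\<lambda>z. z + a)) holomorphic_on UNIV"
    by (rule holomorphic_on_compose[OF _ entire_subset[OF hol]]) (intro holomorphic_intros)
  moreover have False if "\<forall>z. f (z + a) = poly p z" for p
  proof -
    have "f z = poly (pcompose p [:- a, 1:]) z" for z
      using that[rule_format, of "z - a"] by (simp add: poly_pcompose)
    then show False using assms unfolding transcendental_entire_def by blast
  qed
  ultimately show ?thesis unfolding transcendental_entire_def by (auto simp: o_def)
qed

lemma fwd_diff_translate: "fwd_diff n (\<lambda>z. f (z + a)) z = fwd_diff n f (z + a)"
  by (induction n arbitrary: z) (simp_all add: add.commute add.left_commute)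

text \<open>At a maximum point of \<open>fwd_diff n f\<close> on a large circle, the lower bound for
  the difference and the equation for \<open>H\<close> keep \<open>norm (H z)\<close> below a
  multiple of \<open>(1 + r) ^ (d + n)\<close>. This is incompatible with a large minimum
  modulus.\<close>

lemma quotient_polynomial_at_0:
  assumes f: "transcendental_entire f" "growth l f" and l: "0 < l" "l < 1 / 2"
    and H: "H holomorphic_on UNIV" "\<And>z. poly Q z * f z = H z * fwd_diff n f z"
    and nz: "poly Q 0 * f 0 \<noteq> 0"
  shows "\<exists>p. \<forall>z. H z = poly p z"
proof (rule ccontr)
  assume np: "\<nexists>p. \<forall>z. H z = poly p z"
  note hol = growthD[OF f(2)]
  have l0: "l \<ge> 0" using l by simp
  have gD: "growth l (fwd_diff n f)" by (rule growth_fwd_diff[OF f(2) l0])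
  note hD = growthD[OF gD]
  have gQf: "growth l (\<lambda>z. poly Q z * f z)" by (rule growth_mult[OF growth_poly[OF l(1)] f(2)])
  obtain K d where K: "K \<ge> 0" "\<And>z. norm (poly Q z) \<le> K * (1 + norm z) ^ d"
    using poly_norm_le[of Q] by metis
  have sp: "superpoly f" by (rule transcendental_imp_superpoly[OF f(1)])
  have "\<forall>\<^sub>F r in at_top. 1 ^ n * max_mod f r \<le> 2 * r ^ n * max_mod (fwd_diff n f) r"
    by (rule max_mod_fwd_diff_ge[OF f(2) sp]) (use l in auto)
  moreover have "\<forall>\<^sub>F r in at_top. 1 * r ^ 0 \<le> max_mod f r" using sp unfolding superpoly_def by blast
  ultimately have "\<forall>\<^sub>F r in at_top. max_mod f r \<le> 2 * r ^ n * max_mod (fwd_diff n f) r \<and> 1 \<le> max_mod f r"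
    by eventually_elim simp
  then obtain r0 where r0: "\<And>r. r \<ge> r0 \<Longrightarrow> max_mod f r \<le> 2 * r ^ n * max_mod (fwd_diff n f) r \<and> 1 \<le> max_mod f r"
    unfolding eventually_at_top_linorder by blast
  \<comment> \<open>The second argument bounds \<open>H\<close> on the disc of radius
    \<open>r0\<close>, so the radius found next must lie where the estimates hold;
    \<open>2 * K + 1\<close> beats the constant \<open>2 * K\<close> of the final
    comparison.\<close>
  define A where "A = max (2 * K + 1) (max_mod H (max r0 0))"
  obtain r where r: "r \<ge> 0" "\<forall>z. norm z = r \<longrightarrow> norm (H z) > A * (1 + r) ^ (d + n)"
    by (rule minimum_modulus_unbounded[OF gQf gD H nz l np])
  have A: "A \<ge> 2 * K + 1" "A \<ge> max_mod H (max r0 0)" "A > 0" using K(1) by (auto simp: A_def)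
  have rr: "r \<ge> r0"
  proof (rule ccontr)
    assume "\<not> r \<ge> r0"
    then have "norm (complex_of_real r) \<le> max r0 0" using r(1) by simp
    then have "norm (H (of_real r)) \<le> A * 1" using norm_le_max_mod[OF H(1)] A(2) by fastforce
    also have "\<dots> \<le> A * (1 + r) ^ (d + n)" using A(3) r(1) by (intro mult_left_mono one_le_power) auto
    finally show False using r(2)[rule_format, of "of_real r"] r(1) by simp
  qed
  define M where "M = max_mod (fwd_diff n f) r"
  have M: "max_mod f r \<le> 2 * r ^ n * M" "1 \<le> max_mod f r" using r0[OF rr] by (auto simp: M_def)
  have M0: "M > 0"
  proof (rule ccontr)
    assume "\<not> M > 0"
    then have "2 * r ^ n * M \<le> 0" using r(1) by (intro mult_nonneg_nonpos) auto
    then show False using M by linarith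
  qed
  obtain z where z: "norm z = r" "norm (fwd_diff n f z) = M"
    using max_mod_attained[OF hD r(1)] unfolding M_def by blast
  have "A * (1 + r) ^ (d + n) * M \<le> norm (H z) * M"
    using r(2)[rule_format, OF z(1)] M0 by (intro mult_right_mono) auto
  also have "\<dots> = norm (poly Q z) * norm (f z)" using H(2)[of z] z(2) by (metis norm_mult)
  also have "\<dots> \<le> (K * (1 + r) ^ d) * (2 * r ^ n * M)"
    using K(2)[of z] K(1) z(1) M norm_le_max_mod_sphere[OF hol z(1)] r(1) by (intro mult_mono) auto
  also have "\<dots> \<le> (K * (1 + r) ^ d) * (2 * (1 + r) ^ n * M)"
    using K(1) r(1) M0 by (intro mult_left_mono mult_right_mono power_mono) auto
  also have "\<dots> = 2 * K * (1 + r) ^ (d + n) * M" by (simp add: power_add)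
  finally have "A * ((1 + r) ^ (d + n) * M) \<le> 2 * K * ((1 + r) ^ (d + n) * M)" by (simp add: mult.assoc)
  moreover have "(1 + r) ^ (d + n) * M > 0" using r(1) M0 by simp
  ultimately have "A \<le> 2 * K" by (rule mult_right_le_imp_le)
  then show False using A(1) by linarith
qed

text \<open>The finite products are normalized at the origin. Growth and transcendence survive
  translations, and differences commute with them, so a point where \<open>Q f\<close> does not
  vanish can be moved to 0.\<close>

lemma quotient_polynomial:
  assumes f: "transcendental_entire f" "growth l f" and l: "0 < l" "l < 1 / 2"
    and H: "H holomorphic_on UNIV" "\<And>z. poly Q z * f z = H z * fwd_diff n f z" and Q: "Q \<noteq> 0"
  shows "\<exists>p. \<forall>z. H z = poly p z"
proof -
  note hol = growthD[OF f(2)]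
  obtain z1 where z1: "f z1 \<noteq> 0"
    using superpoly_nonzero[OF transcendental_imp_superpoly[OF f(1)]] by blast
  obtain z2 where z2: "poly Q z2 \<noteq> 0" using Q poly_all_0_iff_0 by blast
  have "\<forall>\<^sub>F w in at 0. poly Q w * f w \<noteq> 0"
    using entire_eventually_nonzero[OF hol z1, of 0] entire_eventually_nonzero[OF entire_poly z2, of 0]
    by eventually_elim simp
  then obtain a where a: "poly Q a * f a \<noteq> 0" using eventually_happens[of _ "at (0::complex)"] by auto
  have "\<exists>p. \<forall>z. H (z + a) = poly p z"
  proof (rule quotient_polynomial_at_0)
    show "transcendental_entire (\<lambda>z. f (z + a))" by (rule transcendental_translate[OF f(1)])
    show "growth l (\<lambda>z. f (z + a))" by (rule growth_translate[OF f(2)]) (use l in simp)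
    have "(H \<circ> (\<lambda>z. z + a)) holomorphic_on UNIV"
      by (rule holomorphic_on_compose[OF _ entire_subset[OF H(1)]]) (intro holomorphic_intros)
    then show "(\<lambda>z. H (z + a)) holomorphic_on UNIV" by (simp add: o_def)
    show "poly (pcompose Q [:a, 1:]) z * f (z + a) = H (z + a) * fwd_diff n (\<lambda>z. f (z + a)) z" for z
      unfolding fwd_diff_translate using H(2)[of "z + a"] by (simp add: poly_pcompose add.commute)
    show "poly (pcompose Q [:a, 1:]) 0 * f (0 + a) \<noteq> 0" using a by (simp add: poly_pcompose)
  qed (use l in auto)
  then obtain p where p: "\<And>z. H (z + a) = poly p z" by blast
  have "H z = poly (pcompose p [:- a, 1:]) z" for z
    using p[of "z - a"] by (simp add: poly_pcompose)
  then show ?thesis by blast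
qed

text \<open>The lower bound for the difference rules out, for instance, functions of period
  1.\<close>

lemma fwd_diff_nonzero:
  assumes "growth l f" "superpoly f" "0 < l" "l < 1"
  obtains z where "fwd_diff n f z \<noteq> 0"
proof -
  have hD: "fwd_diff n f holomorphic_on UNIV" by (rule fwd_diff_holomorphic[OF growthD[OF assms(1)]])
  have "\<forall>\<^sub>F r in at_top. 1 ^ n * max_mod f r \<le> 2 * r ^ n * max_mod (fwd_diff n f) r"
    by (rule max_mod_fwd_diff_ge[OF assms]) simp
  moreover have "\<forall>\<^sub>F r in at_top. 1 * r ^ 0 \<le> max_mod f r" using assms(2) unfolding superpoly_def by blast
  ultimately have "\<forall>\<^sub>F r in at_top. 1 \<le> 2 * r ^ n * max_mod (fwd_diff n f) r \<and> r \<ge> 0"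
    using eventually_ge_at_top[of 0] by eventually_elim simp
  then obtain r where r: "1 \<le> 2 * r ^ n * max_mod (fwd_diff n f) r" "r \<ge> 0"
    using eventually_happens[of _ "at_top :: real filter"] by auto
  obtain z where z: "norm z = r" "norm (fwd_diff n f z) = max_mod (fwd_diff n f) r"
    using max_mod_attained[OF hD r(2)] by blast
  have "fwd_diff n f z \<noteq> 0" using r z by auto
  then show ?thesis by (rule that)
qed

lemma infinite_zeros:
  assumes f: "transcendental_entire f" "growth l f" and l: "0 < l" "l < 1 / 2"
    and nr: "\<not> rational_function (\<lambda>z. fwd_diff n f z / f z)"
  shows "infinite (mero_zeros (\<lambda>z. fwd_diff n f z / f z))"
proof
  assume fin: "finite (mero_zeros (\<lambda>z. fwd_diff n f z / f z))"
  note hol = growthD[OF f(2)]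
  have sp: "superpoly f" by (rule transcendental_imp_superpoly[OF f(1)])
  obtain z1 where z1: "f z1 \<noteq> 0" using superpoly_nonzero[OF sp] by blast
  have "l < 1" using l by simp
  then obtain z2 where z2: "fwd_diff n f z2 \<noteq> 0" using fwd_diff_nonzero[OF f(2) sp l(1)] by blast
  obtain Q H where QH: "Q \<noteq> 0" "H holomorphic_on UNIV" "\<forall>z. poly Q z * f z = H z * fwd_diff n f z"
    by (rule finite_mero_zeros_quotient[OF hol z1 fwd_diff_holomorphic[OF hol] z2 fin])
  obtain p where p: "\<And>z. H z = poly p z" using quotient_polynomial[OF f l QH(2) QH(3)[rule_format] QH(1)] by blast
  obtain z3 where z3: "poly Q z3 \<noteq> 0" using QH(1) poly_all_0_iff_0 by blast
  have "\<forall>\<^sub>F w in at z. fwd_diff n f w / f w = poly Q w / poly p w" for z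
    using entire_eventually_nonzero[OF hol z1, of z] entire_eventually_nonzero[OF entire_poly z3, of z]
  proof eventually_elim
    case (elim w)
    then have "poly p w \<noteq> 0" using QH(3)[rule_format, of w] p[of w] by auto
    then show ?case using QH(3)[rule_format, of w] p[of w] elim by (simp add: field_simps)
  qed
  moreover have "p \<noteq> 0"
  proof
    assume "p = 0"
    then have "poly Q w * f w = 0" for w using QH(3)[rule_format, of w] p[of w] by simp
    moreover have "\<forall>\<^sub>F w in at 0. poly Q w * f w \<noteq> 0"
      using entire_eventually_nonzero[OF hol z1, of 0] entire_eventually_nonzero[OF entire_poly z3, of 0]
      by eventually_elim simp
    ultimately show False using eventually_happens[of _ "at (0::complex)"] by auto
  qed
  ultimately show False using nr unfolding rational_function_def by blast
qed

lemma not_rational: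
  assumes n: "n \<ge> 1" and f: "transcendental_entire f" "growth l f" and l: "0 < l" "l < 1" "real n * l < 1"
  shows "\<not> rational_function (\<lambda>z. fwd_diff n f z / f z)"
proof
  assume "rational_function (\<lambda>z. fwd_diff n f z / f z)"
  then obtain p q where pq: "q \<noteq> 0" "\<And>z. \<forall>\<^sub>F w in at z. fwd_diff n f w / f w = poly p w / poly q w"
    unfolding rational_function_def by blast
  note hol = growthD[OF f(2)]
  note hD = fwd_diff_holomorphic[OF hol, of n]
  have sp: "superpoly f" by (rule transcendental_imp_superpoly[OF f(1)])
  obtain z1 where z1: "f z1 \<noteq> 0" using superpoly_nonzero[OF sp] by blast
  obtain z2 where z2: "fwd_diff n f z2 \<noteq> 0" using fwd_diff_nonzero[OF f(2) sp l(1,2)] by blast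
  obtain z3 where z3: "poly q z3 \<noteq> 0" using pq(1) poly_all_0_iff_0 by blast
  have eq: "poly q z * fwd_diff n f z = poly p z * f z" for z
  proof (rule entire_eq_if_eventually_eq[of "\<lambda>z. poly q z * fwd_diff n f z" "\<lambda>z. poly p z * f z"])
    show "(\<lambda>z. poly q z * fwd_diff n f z) holomorphic_on UNIV" by (rule holomorphic_on_mult[OF entire_poly hD])
    show "(\<lambda>z. poly p z * f z) holomorphic_on UNIV" by (rule holomorphic_on_mult[OF entire_poly hol])
    show "\<forall>\<^sub>F w in at z. poly q w * fwd_diff n f w = poly p w * f w"
      using entire_eventually_nonzero[OF hol z1, of z] entire_eventually_nonzero[OF entire_poly z3, of z] pq(2)[of z]
      by eventually_elim (simp add: field_simps)
  qed
  have "p \<noteq> 0"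
  proof
    assume "p = 0"
    then have "poly q w * fwd_diff n f w = 0" for w using eq[of w] by simp
    moreover have "\<forall>\<^sub>F w in at 0. poly q w * fwd_diff n f w \<noteq> 0"
      using entire_eventually_nonzero[OF hD z2, of 0] entire_eventually_nonzero[OF entire_poly z3, of 0]
      by eventually_elim simp
    ultimately show False using eventually_happens[of _ "at (0::complex)"] by auto
  qed
  then obtain cp Cp Rp where P: "cp > 0" "Cp > 0"
    "\<And>z. norm z \<ge> Rp \<Longrightarrow> cp * norm z ^ degree p \<le> norm (poly p z)"
    "\<And>z. norm z \<ge> Rp \<Longrightarrow> norm (poly p z) \<le> Cp * norm z ^ degree p"
    using poly_norm_asymp by metis
  obtain cq Cq Rq where Q: "cq > 0" "Cq > 0"
    "\<And>z. norm z \<ge> Rq \<Longrightarrow> cq * norm z ^ degree q \<le> norm (poly q z)"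
    "\<And>z. norm z \<ge> Rq \<Longrightarrow> norm (poly q z) \<le> Cq * norm z ^ degree q"
    using poly_norm_asymp[OF pq(1)] by metis
  obtain K where K: "K \<ge> 0"
    "\<forall>\<^sub>F r in at_top. max_mod (fwd_diff n f) r \<le> K * r powr (- (real n * (1 - l))) * max_mod f r"
    using max_mod_fwd_diff_le[OF f(2) sp l(1,2)] by blast
  have sp1: "\<forall>\<^sub>F r in at_top. 1 * r ^ 0 \<le> max_mod f r" using sp unfolding superpoly_def by blast
  have upper: "cq * r ^ degree q * max_mod (fwd_diff n f) r \<le> Cp * r ^ degree p * max_mod f r"
    if r: "r \<ge> 0" "r \<ge> Rp" "r \<ge> Rq" for r
  proof -
    obtain z where z: "norm z = r" "norm (fwd_diff n f z) = max_mod (fwd_diff n f) r"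
      using max_mod_attained[OF hD r(1)] by blast
    have "cq * r ^ degree q * max_mod (fwd_diff n f) r \<le> norm (poly q z) * norm (fwd_diff n f z)"
      using Q(3)[of z] z r max_mod_nonneg[OF hD r(1)] by (simp add: mult_right_mono)
    also have "\<dots> = norm (poly p z) * norm (f z)" using eq[of z] by (metis norm_mult)
    also have "\<dots> \<le> Cp * r ^ degree p * max_mod f r"
      using P(4)[of z] P(2) z r norm_le_max_mod_sphere[OF hol z(1)] by (intro mult_mono) auto
    finally show ?thesis .
  qed
  have lower: "cp * r ^ degree p * max_mod f r \<le> Cq * r ^ degree q * max_mod (fwd_diff n f) r"
    if r: "r \<ge> 0" "r \<ge> Rp" "r \<ge> Rq" for r
  proof -
    obtain z where z: "norm z = r" "norm (f z) = max_mod f r"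
      using max_mod_attained[OF hol r(1)] by blast
    have "cp * r ^ degree p * max_mod f r \<le> norm (poly p z) * norm (f z)"
      using P(3)[of z] z r max_mod_nonneg[OF hol r(1)] by (simp add: mult_right_mono)
    also have "\<dots> = norm (poly q z) * norm (fwd_diff n f z)" using eq[of z] by (metis norm_mult)
    also have "\<dots> \<le> Cq * r ^ degree q * max_mod (fwd_diff n f) r"
      using Q(4)[of z] Q(2) z r norm_le_max_mod_sphere[OF hD z(1)] by (intro mult_mono) auto
    finally show ?thesis .
  qed
  \<comment> \<open>The upper bound makes \<open>degree p - degree q\<close> at most
    \<open>- n * (1 - l)\<close>, which is less than \<open>1 - n\<close>; being an integer, it is
    at most \<open>- n\<close>.\<close>
  have deg: "degree p + n \<le> degree q"
  proof (rule ccontr)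
    assume "\<not> degree p + n \<le> degree q"
    then have d: "degree q + 1 \<le> degree p + n" by simp
    define e where "e = real (degree p) - (real (degree q) - real n * (1 - l))"
    have e: "e > 0" using d l(3) by (simp add: e_def algebra_simps)
    have "filterlim (\<lambda>r. r powr e) at_top at_top" using e by real_asymp
    then have "\<forall>\<^sub>F r in at_top. r powr e > Cq * K / cp" by (simp add: filterlim_at_top_dense)
    with K(2) sp1 eventually_ge_at_top[of "max 1 (max Rp Rq)"] have "\<forall>\<^sub>F r :: real in at_top. False"
    proof eventually_elim
      case (elim r)
      then have r: "r \<ge> 1" "r \<ge> Rp" "r \<ge> Rq" by auto
      have "cp * r ^ degree p * max_mod f r \<le> Cq * r ^ degree q * max_mod (fwd_diff n f) r"
        using lower r by simp
      also have "\<dots> \<le> Cq * r ^ degree q * (K * r powr (- (real n * (1 - l))) * max_mod f r)"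
        using elim Q(2) r by (intro mult_left_mono) auto
      finally have "(cp * r ^ degree p) * max_mod f r \<le> (Cq * K * (r ^ degree q * r powr (- (real n * (1 - l))))) * max_mod f r"
        by (simp add: mult_ac)
      then have "cp * r ^ degree p \<le> Cq * K * (r ^ degree q * r powr (- (real n * (1 - l))))"
        by (rule mult_right_le_imp_le) (use elim in simp)
      moreover have "r ^ degree p = r powr e * (r ^ degree q * r powr (- (real n * (1 - l))))"
        using r by (simp add: e_def flip: powr_realpow powr_add)
      ultimately have "(cp * r powr e) * (r ^ degree q * r powr (- (real n * (1 - l))))
          \<le> (Cq * K) * (r ^ degree q * r powr (- (real n * (1 - l))))" by (simp add: mult_ac)
      then have "cp * r powr e \<le> Cq * K" by (rule mult_right_le_imp_le) (use r in simp)
      then show False using elim P(1) by (simp add: field_simps)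
    qed
    then show False by simp
  qed
  \<comment> \<open>Exceeds the constant \<open>2 * Cp / cq\<close> that remains once
    \<open>degree p + n \<le> degree q\<close> is used; the lower bound allows every
    \<open>m \<ge> 1\<close>.\<close>
  define m where "m = 2 * Cp / cq + 1"
  have m: "m \<ge> 1" using P(2) Q(1) by (simp add: m_def)
  have "\<forall>\<^sub>F r in at_top. m ^ n * max_mod f r \<le> 2 * r ^ n * max_mod (fwd_diff n f) r"
    by (rule max_mod_fwd_diff_ge[OF f(2) sp l(1,2) m])
  with sp1 eventually_ge_at_top[of "max 1 (max Rp Rq)"] have "\<forall>\<^sub>F r :: real in at_top. False"
  proof eventually_elim
    case (elim r)
    then have r: "r \<ge> 1" "r \<ge> Rp" "r \<ge> Rq" by auto
    define M where "M = max_mod (fwd_diff n f) r"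
    have M: "M \<ge> 0" unfolding M_def by (rule max_mod_nonneg[OF hD]) (use r in simp)
    have "r ^ degree p * (cq * (r ^ n * M)) = cq * r ^ (degree p + n) * M" by (simp add: power_add)
    also have "\<dots> \<le> cq * r ^ degree q * M"
      using deg r Q(1) M by (intro mult_right_mono mult_left_mono power_increasing) auto
    also have "\<dots> \<le> r ^ degree p * (Cp * max_mod f r)" using upper r by (simp add: M_def mult_ac)
    finally have "cq * (r ^ n * M) \<le> Cp * max_mod f r"
      by (rule mult_left_le_imp_le) (use r in simp)
    then have "2 * (r ^ n * M) \<le> (2 * Cp / cq) * max_mod f r" using Q(1) by (simp add: field_simps)
    moreover have "m ^ n * max_mod f r \<le> 2 * (r ^ n * M)" using elim by (simp add: M_def)
    \<comment> \<open>Here \<open>n \<ge> 1\<close> enters; for \<open>n = 0\<close> the quotient is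
      rational.\<close>
    moreover have "m * max_mod f r \<le> m ^ n * max_mod f r"
      using elim m n power_increasing[of 1 n m] by (intro mult_right_mono) auto
    ultimately have "m * max_mod f r \<le> (2 * Cp / cq) * max_mod f r" by linarith
    then have "m \<le> 2 * Cp / cq" by (rule mult_right_le_imp_le) (use elim in simp)
    then show False by (simp add: m_def)
  qed
  then show False by simp
qed

theorem theorem1p2:
  fixes f :: "complex \<Rightarrow> complex" and n :: nat
  assumes "n \<ge> 1"
    and "transcendental_entire f"
    and "entire_order f < ereal (1/2)"
  defines "G \<equiv> (\<lambda>z. fwd_diff n f z / f z)"
  shows "(\<not> rational_function G \<longrightarrow> infinite (mero_zeros G))
       \<and> (entire_order f < ereal (min (1 / real n) (1/2)) \<longrightarrow>
            \<not> rational_function G \<and> infinite (mero_zeros G))"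
proof -
  have hol: "f holomorphic_on UNIV" using assms(2) by (simp add: transcendental_entire_def)
  obtain l where l: "0 < l" "l < 1 / 2" "growth l f"
    using entire_order_imp_growth[OF hol assms(3)] by auto
  have inf: "infinite (mero_zeros G)" if "\<not> rational_function G"
    using infinite_zeros[OF assms(2) l(3,1,2)] that unfolding G_def by blast
  moreover have "\<not> rational_function G" if ord: "entire_order f < ereal (min (1 / real n) (1/2))"
  proof -
    have "min (1 / real n) (1/2) > 0" using assms(1) by simp
    \<comment> \<open>A second exponent is chosen: \<open>l\<close> is only known to lie below
      \<open>1 / 2\<close>, whereas \<open>n * k < 1\<close> is required here.\<close>
    then obtain k where k: "0 < k" "k < min (1 / real n) (1/2)" "growth k f"
      using entire_order_imp_growth[OF hol ord] by blast
    have "real n * k < 1" using k assms(1) by (simp add: field_simps)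
    then show ?thesis unfolding G_def using k by (intro not_rational[OF assms(1,2) k(3)]) auto
  qed
  ultimately show ?thesis by blast
qed

end
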